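(* Let $L,H,d>0$, $D:=(-L,L)$, $\Omega_1:=D\times(-H-d,-H)$. Let $\beta>0$ and $\tau,\alpha\ge 0$. Let $\sigma_1\in C^2(\overline{\Omega}_1)$ with $\min_{\overline{\Omega}_1}\sigma_1>0$, let $\sigma_2\in(0,\infty)$, and let $h_1:\bar D\times[-H-d,-H]\times[-H,\infty)\to[0,\infty)$ and $h_2:\bar D\times[-H,\infty)\times[-H,\infty)\to[0,\infty)$ be $C^2$-smooth functions of $(x,z,w)$ such that, for all $(x,w)\in D\times[-H,\infty)$, $$h_1(x,-H,w)=h_2(x,-H,w),\qquad \sigma_1(x,-H)\,\partial_z h_1(x,-H,w)=\sigma_2\,\partial_z h_2(x,-H,w).$$ Assume that there is $V>0$ such that $$h_1(x,-H-d,w)=0\quad\text{and}\quad h_2(x,w,w)=V,\qquad (x,w)\in\bar D\times[-H,\infty).$$ Let $u\in\bar S_0$ be a weak solution of $$\beta\partial_x^4u-\left(\tau+\alpha\|\partial_xu\|_{L_2(D)}^2\right)\partial_x^2u+\partial\mathbb{I}_{\bar S_0}(u)\ni -g(u)\quad\text{in }D,$$ that is, for all $w\in\bar S_0$ $$\int_D\left\{\beta\,\partial_x^2u\,\partial_x^2(w-u)+\left[\tau+\alpha\|\partial_xu\|_{L_2(D)}^2\right]\partial_xu\,\partial_x(w-u)\right\}\mathrm{d}x\ \ge\ -\int_D g(u)(w-u)\,\mathrm{d}x .$$ If the coincidence set $\mathcal{C}(u)=\{x\in D: u(x)=-H\}$ is non-empty, then it is an interval.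
   Context: Function spaces and sets. $H_D^2(D):=\{v\in H^2(D): v(\pm L)=\partial_xv(\pm L)=0\}$ and $\bar S_0:=\{v\in H_D^2(D): v\ge -H\text{ in }D\}$, a closed convex subset of $H_D^2(D)$. $\mathbb{I}_{\bar S_0}$ is the indicator function of $\bar S_0$ and $\partial\mathbb{I}_{\bar S_0}$ its subdifferential in $H_D^2(D)$; the inclusion is understood exactly in the sense of the integral inequality given in the claim. An interval may reduce to a single point. Geometry. For $u\in\bar S_0$: $\Omega_2(u):=\{(x,z)\in D\times\mathbb{R}: -H<z<u(x)\}$, $\Sigma(u):=\{(x,-H): x\in D,\ u(x)>-H\}$, $\Omega(u):=\{(x,z)\in D\times\mathbb{R}: -H-d<z<u(x)\}=\Omega_1\cup\Omega_2(u)\cup\Sigma(u)$. Data. $\sigma:=\sigma_1$ in $\Omega_1$ and $\sigma:=\sigma_2$ in $D\times(-H,\infty)$. $h_u(x,z):=h_1(x,z,u(x))$ for $(x,z)\in\overline{\Omega}_1$ and $h_u(x,z):=h_2(x,z,u(x))$ for $(x,z)\in\overline{\Omega_2(u)}$. For a derivative $\partial_\bullet h_i$ of $h_i=h_i(x,z,w)$, $(\partial_\bullet h_i)_u(x,z):=(\partial_\bullet h_i)(x,z,u(x))$. Potential. For $u\in\bar S_0$, $\psi_u\in h_u+H_0^1(\Omega(u))$ is the unique variational solution of the transmission problem $\mathrm{div}(\sigma\nabla\psi_u)=0$ in $\Omega(u)$, with zero jumps of $\psi_u$ and $\sigma\partial_z\psi_u$ across $\Sigma(u)$, $\psi_u=h_u$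 on $\partial\Omega(u)$; i.e. $\int_{\Omega(u)}\sigma\nabla\psi_u\cdot\nabla\varphi\,\mathrm{d}(x,z)=0$ for all $\varphi\in H_0^1(\Omega(u))$. Put $\psi_{u,1}:=\psi_u|_{\overline{\Omega}_1}$ and $\psi_{u,2}:=\psi_u|_{\overline{\Omega_2(u)}}$. It is known that $\psi_{u,1}\in H^2(\Omega_1)$, $\psi_{u,2}\in H^2(\Omega_2(u))$ and that the gradient traces below make sense and give $g(u)\in L_2(D)$. Electrostatic force. For $u\in\bar S_0$ and $x\in D$, $$g(u)(x):=\mathfrak{g}(u)(x)-\frac{\sigma_2}{2}\left[((\partial_xh_2)_u)^2+((\partial_zh_2)_u+(\partial_wh_2)_u)^2\right](x,u(x))+\left[\sigma_1(\partial_wh_1)_u\,\partial_z\psi_{u,1}\right](x,-H-d),$$ where $$\mathfrak{g}(u)(x):=\frac{\sigma_2}{2}\left(1+(\partial_xu(x))^2\right)\left[\partial_z\psi_{u,2}-(\partial_zh_2)_u-(\partial_wh_2)_u\right]^2(x,u(x)),\quad x\in D\setminus\mathcal{C}(u),$$ $$\mathfrak{g}(u)(x):=\frac{\sigma_2}{2}\left[\frac{\sigma_1}{\sigma_2}\partial_z\psi_{u,1}-(\partial_zh_2)_u-(\partial_wh_2)_u\right]^2(x,-H),\quad x\in\mathcal{C}(u).$$ *)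

theory Defs
  imports "HOL-Analysis.Analysis"
begin

section \<open>Differentiability classes and Sobolev spaces\<close>

text \<open>
  \<open>Ck_on k S f\<close>: \<open>f\<close> is of class $C^k$ on \<open>S\<close>. It is used for open sets and for closed convex
  sets with non-empty interior; in the latter case the derivatives at boundary points are taken
  within \<open>S\<close>, which amounts to all partial derivatives of order at most \<open>k\<close> in the interior
  extending continuously to \<open>S\<close>.
\<close>

primrec Ck_on :: "nat \<Rightarrow> 'a::euclidean_space set \<Rightarrow> ('a \<Rightarrow> real) \<Rightarrow> bool" where
  "Ck_on 0 S f \<longleftrightarrow> continuous_on S f"
| "Ck_on (Suc k) S f \<longleftrightarrow> continuous_on S f \<and>
     (\<exists>f'. (\<forall>x\<in>S. (f has_derivative f' x) (at x within S)) \<and>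
           (\<forall>b\<in>Basis. Ck_on k S (\<lambda>x. f' x b)))"

definition partial :: "'a::euclidean_space set \<Rightarrow> 'a \<Rightarrow> ('a \<Rightarrow> real) \<Rightarrow> 'a \<Rightarrow> real" where
  "partial S b f x = frechet_derivative f (at x within S) b"

definition test_functions :: "'a::euclidean_space set \<Rightarrow> ('a \<Rightarrow> real) set" where
  "test_functions U = {\<phi>. (\<forall>k. Ck_on k UNIV \<phi>) \<and>
     (\<exists>K. compact K \<and> K \<subseteq> U \<and> (\<forall>x. x \<notin> K \<longrightarrow> \<phi> x = 0))}"

definition L1_loc :: "'a::euclidean_space set \<Rightarrow> ('a \<Rightarrow> real) set" where
  "L1_loc U = {f. \<forall>K. compact K \<and> K \<subseteq> U \<longrightarrow> integrable (lebesgue_on K) f}"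

definition L2 :: "'a::euclidean_space set \<Rightarrow> ('a \<Rightarrow> real) set" where
  "L2 U = {f. f \<in> borel_measurable (lebesgue_on U) \<and> integrable (lebesgue_on U) (\<lambda>x. (f x)\<^sup>2)}"

definition L2_norm :: "'a::euclidean_space set \<Rightarrow> ('a \<Rightarrow> real) \<Rightarrow> real" where
  "L2_norm U f = sqrt (LINT x|lebesgue_on U. (f x)\<^sup>2)"

text \<open>
  Elements of the Lebesgue and Sobolev spaces are represented by functions on the whole space
  whose values outside \<open>U\<close> are irrelevant; in particular restrictions to smaller open sets are
  implicit. Weak derivatives are determined up to a null set of \<open>U\<close>.
\<close>

definition has_weak_partial ::
    "'a::euclidean_space set \<Rightarrow> 'a \<Rightarrow> ('a \<Rightarrow> real) \<Rightarrow> ('a \<Rightarrow> real) \<Rightarrow> bool" where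
  "has_weak_partial U b f g \<longleftrightarrow> f \<in> L1_loc U \<and> g \<in> L1_loc U \<and>
     (\<forall>\<phi>\<in>test_functions U.
        (LINT x|lebesgue_on U. f x * partial UNIV b \<phi> x) = - (LINT x|lebesgue_on U. g x * \<phi> x))"

definition weak_partial :: "'a::euclidean_space set \<Rightarrow> 'a \<Rightarrow> ('a \<Rightarrow> real) \<Rightarrow> 'a \<Rightarrow> real" where
  "weak_partial U b f = (SOME g. has_weak_partial U b f g)"

primrec sobolev :: "nat \<Rightarrow> 'a::euclidean_space set \<Rightarrow> ('a \<Rightarrow> real) set" where
  "sobolev 0 U = L2 U"
| "sobolev (Suc k) U =
     {f \<in> L2 U. \<forall>b\<in>Basis. \<exists>g. has_weak_partial U b f g \<and> g \<in> sobolev k U}"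

definition H1_norm :: "'a::euclidean_space set \<Rightarrow> ('a \<Rightarrow> real) \<Rightarrow> real" where
  "H1_norm U f = sqrt ((L2_norm U f)\<^sup>2 + (\<Sum>b\<in>Basis. (L2_norm U (weak_partial U b f))\<^sup>2))"

definition H1_0 :: "'a::euclidean_space set \<Rightarrow> ('a \<Rightarrow> real) set" where
  "H1_0 U = {f \<in> sobolev 1 U.
     \<forall>\<epsilon>>0. \<exists>\<phi>\<in>test_functions U. H1_norm U (\<lambda>x. f x - \<phi> x) < \<epsilon>}"

text \<open>
  Boundary trace of \<open>f\<close> from inside \<open>U\<close>, as the limit of averages over \<open>U \<inter> ball p r\<close>. For
  $f \in H^1$ near a Lipschitz portion of the boundary, this limit exists at almost every point of
  that portion and is the usual trace. It does not depend on the representative of \<open>f\<close>, so it can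
  be applied to a weak derivative.
\<close>

definition trace :: "'a::euclidean_space set \<Rightarrow> ('a \<Rightarrow> real) \<Rightarrow> 'a \<Rightarrow> real" where
  "trace U f p = Lim (at_right 0)
     (\<lambda>r. (LINT y|lebesgue_on (U \<inter> ball p r). f y) / measure lebesgue (U \<inter> ball p r))"

section \<open>Function spaces and geometry\<close>

definition dom_D :: "real \<Rightarrow> real set" where
  "dom_D L = {-L<..<L}"

text \<open>
  Elements of $H^2(D)$ are taken in their representative that is $C^1$ on the closed interval, so
  that pointwise conditions on $v$ and on $\partial_x v$ make sense. Accordingly, $\partial_x v$ in
  \<open>D\<close> is rendered by \<open>deriv v\<close>, and $\partial_x^2 v$ by \<open>D2 L v\<close>, the weak derivative of \<open>deriv v\<close>.
\<close>

definition H2_D :: "real \<Rightarrow> (real \<Rightarrow> real) set" where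
  "H2_D L = {v \<in> sobolev 2 (dom_D L). Ck_on 1 {-L..L} v \<and> v (-L) = 0 \<and> v L = 0 \<and>
     (v has_real_derivative 0) (at (-L) within {-L..L}) \<and>
     (v has_real_derivative 0) (at L within {-L..L})}"

definition D2 :: "real \<Rightarrow> (real \<Rightarrow> real) \<Rightarrow> real \<Rightarrow> real" where
  "D2 L v = weak_partial (dom_D L) 1 (deriv v)"

definition S0_bar :: "real \<Rightarrow> real \<Rightarrow> (real \<Rightarrow> real) set" where
  "S0_bar L H = {v \<in> H2_D L. \<forall>x\<in>dom_D L. v x \<ge> -H}"

definition coincidence_set :: "real \<Rightarrow> real \<Rightarrow> (real \<Rightarrow> real) \<Rightarrow> real set" where
  "coincidence_set L H u = {x \<in> dom_D L. u x = -H}"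

definition Omega1 :: "real \<Rightarrow> real \<Rightarrow> real \<Rightarrow> (real \<times> real) set" where
  "Omega1 L H d = dom_D L \<times> {-H-d<..<-H}"

definition Omega2 :: "real \<Rightarrow> real \<Rightarrow> (real \<Rightarrow> real) \<Rightarrow> (real \<times> real) set" where
  "Omega2 L H u = {(x, z). x \<in> dom_D L \<and> -H < z \<and> z < u x}"

definition Omega :: "real \<Rightarrow> real \<Rightarrow> real \<Rightarrow> (real \<Rightarrow> real) \<Rightarrow> (real \<times> real) set" where
  "Omega L H d u = {(x, z). x \<in> dom_D L \<and> -H-d < z \<and> z < u x}"

section \<open>Data, potential and electrostatic force\<close>

text \<open>The arguments of $h_i$ are the triples $(x,z,w)$.\<close>

definition dom_h1 :: "real \<Rightarrow> real \<Rightarrow> real \<Rightarrow> (real \<times> real \<times> real) set" where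
  "dom_h1 L H d = {-L..L} \<times> {-H-d..-H} \<times> {-H..}"

definition dom_h2 :: "real \<Rightarrow> real \<Rightarrow> (real \<times> real \<times> real) set" where
  "dom_h2 L H = {-L..L} \<times> {-H..} \<times> {-H..}"

abbreviation e_x :: "real \<times> real \<times> real" where "e_x \<equiv> (1, 0, 0)"
abbreviation e_z :: "real \<times> real \<times> real" where "e_z \<equiv> (0, 1, 0)"
abbreviation e_w :: "real \<times> real \<times> real" where "e_w \<equiv> (0, 0, 1)"

text \<open>\<open>at_u u k\<close> is $k_u(x,z) = k(x,z,u(x))$.\<close>

definition at_u :: "(real \<Rightarrow> real) \<Rightarrow> (real \<times> real \<times> real \<Rightarrow> real) \<Rightarrow> real \<times> real \<Rightarrow> real" where
  "at_u u k = (\<lambda>(x, z). k (x, z, u x))"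

definition h_of :: "real \<Rightarrow> (real \<times> real \<times> real \<Rightarrow> real) \<Rightarrow> (real \<times> real \<times> real \<Rightarrow> real) \<Rightarrow>
    (real \<Rightarrow> real) \<Rightarrow> real \<times> real \<Rightarrow> real" where
  "h_of H h1 h2 u = (\<lambda>(x, z). if z \<le> -H then at_u u h1 (x, z) else at_u u h2 (x, z))"

definition sigma :: "real \<Rightarrow> (real \<times> real \<Rightarrow> real) \<Rightarrow> real \<Rightarrow> real \<times> real \<Rightarrow> real" where
  "sigma H \<sigma>1 \<sigma>2 = (\<lambda>(x, z). if z < -H then \<sigma>1 (x, z) else \<sigma>2)"

definition is_potential :: "real \<Rightarrow> real \<Rightarrow> real \<Rightarrow> (real \<times> real \<Rightarrow> real) \<Rightarrow> real \<Rightarrow>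
    (real \<times> real \<times> real \<Rightarrow> real) \<Rightarrow> (real \<times> real \<times> real \<Rightarrow> real) \<Rightarrow> (real \<Rightarrow> real) \<Rightarrow>
    (real \<times> real \<Rightarrow> real) \<Rightarrow> bool" where
  "is_potential L H d \<sigma>1 \<sigma>2 h1 h2 u \<psi> \<longleftrightarrow>
     (\<lambda>p. \<psi> p - h_of H h1 h2 u p) \<in> H1_0 (Omega L H d u) \<and>
     (\<forall>\<phi>\<in>H1_0 (Omega L H d u).
        (LINT p|lebesgue_on (Omega L H d u). sigma H \<sigma>1 \<sigma>2 p *
           (\<Sum>b\<in>Basis. weak_partial (Omega L H d u) b \<psi> p * weak_partial (Omega L H d u) b \<phi> p)) = 0)"

text \<open>The potential exists and is unique up to null sets for every \<open>u \<in> S0_bar L H\<close> (Lax--Milgram).\<close>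

definition potential :: "real \<Rightarrow> real \<Rightarrow> real \<Rightarrow> (real \<times> real \<Rightarrow> real) \<Rightarrow> real \<Rightarrow>
    (real \<times> real \<times> real \<Rightarrow> real) \<Rightarrow> (real \<times> real \<times> real \<Rightarrow> real) \<Rightarrow> (real \<Rightarrow> real) \<Rightarrow>
    real \<times> real \<Rightarrow> real" where
  "potential L H d \<sigma>1 \<sigma>2 h1 h2 u = (SOME \<psi>. is_potential L H d \<sigma>1 \<sigma>2 h1 h2 u \<psi>)"

definition dz_psi1 :: "real \<Rightarrow> real \<Rightarrow> real \<Rightarrow> (real \<times> real \<Rightarrow> real) \<Rightarrow> real \<Rightarrow>
    (real \<times> real \<times> real \<Rightarrow> real) \<Rightarrow> (real \<times> real \<times> real \<Rightarrow> real) \<Rightarrow> (real \<Rightarrow> real) \<Rightarrow>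
    real \<times> real \<Rightarrow> real" where
  "dz_psi1 L H d \<sigma>1 \<sigma>2 h1 h2 u = trace (Omega1 L H d)
     (weak_partial (Omega1 L H d) (0, 1) (potential L H d \<sigma>1 \<sigma>2 h1 h2 u))"

definition dz_psi2 :: "real \<Rightarrow> real \<Rightarrow> real \<Rightarrow> (real \<times> real \<Rightarrow> real) \<Rightarrow> real \<Rightarrow>
    (real \<times> real \<times> real \<Rightarrow> real) \<Rightarrow> (real \<times> real \<times> real \<Rightarrow> real) \<Rightarrow> (real \<Rightarrow> real) \<Rightarrow>
    real \<times> real \<Rightarrow> real" where
  "dz_psi2 L H d \<sigma>1 \<sigma>2 h1 h2 u = trace (Omega2 L H u)
     (weak_partial (Omega2 L H u) (0, 1) (potential L H d \<sigma>1 \<sigma>2 h1 h2 u))"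

definition g_frak :: "real \<Rightarrow> real \<Rightarrow> real \<Rightarrow> (real \<times> real \<Rightarrow> real) \<Rightarrow> real \<Rightarrow>
    (real \<times> real \<times> real \<Rightarrow> real) \<Rightarrow> (real \<times> real \<times> real \<Rightarrow> real) \<Rightarrow> (real \<Rightarrow> real) \<Rightarrow>
    real \<Rightarrow> real" where
  "g_frak L H d \<sigma>1 \<sigma>2 h1 h2 u x =
    (if x \<in> coincidence_set L H u then
       \<sigma>2 / 2 *
         (\<sigma>1 (x, -H) / \<sigma>2 * dz_psi1 L H d \<sigma>1 \<sigma>2 h1 h2 u (x, -H)
          - at_u u (partial (dom_h2 L H) e_z h2) (x, -H)
          - at_u u (partial (dom_h2 L H) e_w h2) (x, -H))\<^sup>2
     else
       \<sigma>2 / 2 * (1 + (deriv u x)\<^sup>2) *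
         (dz_psi2 L H d \<sigma>1 \<sigma>2 h1 h2 u (x, u x)
          - at_u u (partial (dom_h2 L H) e_z h2) (x, u x)
          - at_u u (partial (dom_h2 L H) e_w h2) (x, u x))\<^sup>2)"

definition g_force :: "real \<Rightarrow> real \<Rightarrow> real \<Rightarrow> (real \<times> real \<Rightarrow> real) \<Rightarrow> real \<Rightarrow>
    (real \<times> real \<times> real \<Rightarrow> real) \<Rightarrow> (real \<times> real \<times> real \<Rightarrow> real) \<Rightarrow> (real \<Rightarrow> real) \<Rightarrow>
    real \<Rightarrow> real" where
  "g_force L H d \<sigma>1 \<sigma>2 h1 h2 u x =
     g_frak L H d \<sigma>1 \<sigma>2 h1 h2 u x
     - \<sigma>2 / 2 * ((at_u u (partial (dom_h2 L H) e_x h2) (x, u x))\<^sup>2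
         + (at_u u (partial (dom_h2 L H) e_z h2) (x, u x)
            + at_u u (partial (dom_h2 L H) e_w h2) (x, u x))\<^sup>2)
     + \<sigma>1 (x, -H-d) * at_u u (partial (dom_h1 L H d) e_w h1) (x, -H-d)
         * dz_psi1 L H d \<sigma>1 \<sigma>2 h1 h2 u (x, -H-d)"

text \<open>
  Weak solutions of the variational inequality, with right-hand side $-g$: the inclusion with the
  subdifferential of the indicator function of \<open>S0_bar L H\<close> is understood in this sense.
\<close>

definition weak_solution :: "real \<Rightarrow> real \<Rightarrow> real \<Rightarrow> real \<Rightarrow> real \<Rightarrow> (real \<Rightarrow> real) \<Rightarrow>
    (real \<Rightarrow> real) \<Rightarrow> bool" where
  "weak_solution L H \<beta> \<tau> \<alpha> g u \<longleftrightarrow> u \<in> S0_bar L H \<and>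
     (\<forall>w\<in>S0_bar L H.
        (LINT x|lebesgue_on (dom_D L).
           \<beta> * D2 L u x * D2 L (\<lambda>y. w y - u y) x
           + (\<tau> + \<alpha> * (L2_norm (dom_D L) (deriv u))\<^sup>2) * deriv u x * deriv (\<lambda>y. w y - u y) x)
        \<ge> - (LINT x|lebesgue_on (dom_D L). g x * (w x - u x)))"

end

theory Submission
  imports Defs
begin

text \<open>
  The boundary conditions on $h_1$ and $h_2$ make the second and third terms of $g(u)$ vanish, so
  that $g(u) \ge 0$. If $u(p) = u(q) = -H$ with $p < q$, then $\partial_x u$ vanishes at both
  points, so the function $w$ that equals $-H$ on $[p,q]$ and $u$ elsewhere is admissible. Since
  $w \le u$, the variational inequality yields
  $\int_p^q \beta (\partial_x^2 u)^2 + (\tau + \alpha \|\partial_x u\|^2) (\partial_x u)^2 \le 0$,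
  whence $u = -H$ on $[p,q]$.
\<close>

section \<open>Smooth cutoff functions on the real line\<close>

text \<open>The competitor \<open>w\<close> is in general only C^1, since its second derivative may
  jump at \<open>p\<close> and \<open>q\<close>. Its membership in \<open>H2_D\<close> therefore has
  to be shown with weak derivatives, which are tested only against smooth functions of compact
  support. Such functions need not vanish at \<open>p\<close> or \<open>q\<close>, whereas the
  truncation calls for integration by parts over \<open>{p..q}\<close> itself; smooth cutoffs of
  uniformly bounded variation bridge this gap. Applied to the constant 1, the same integration by
  parts is a fundamental theorem of calculus for weak derivatives. It shows that weak derivatives of
  continuous functions are unique up to null sets, which matters because \<open>D2\<close> is an
  arbitrary choice among them, and it finally turns \<open>u2 = 0\<close> almost everywhere into
  \<open>u1 = 0\<close> everywhere on \<open>{p..q}\<close>. The slopes vanish at \<open>p\<close>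
  and \<open>q\<close> because contact points are interior minima of \<open>u\<close>. What remains
  of the force after cancellation is a nonnegative factor times a square, so its sign needs no
  information on the traces of the potential.\<close>

lemma Ck_on_Suc_real:
  fixes f :: "real \<Rightarrow> real"
  shows "Ck_on (Suc k) UNIV f \<longleftrightarrow> (\<exists>f'. (\<forall>x. (f has_real_derivative f' x) (at x)) \<and> Ck_on k UNIV f')"
proof
  assume "Ck_on (Suc k) UNIV f"
  then obtain f' where f': "\<And>x. (f has_derivative f' x) (at x)" "Ck_on k UNIV (\<lambda>x. f' x 1)"
    unfolding Ck_on.simps(2) Basis_real_def by blast
  have "(f has_real_derivative f' x 1) (at x)" for x
  proof (rule has_derivative_imp_has_field_derivative[OF f'(1)])
    show "y * f' x 1 = f' x y" for y
      using linear_cmul[OF has_derivative_linear[OF f'(1)[of x]], of y 1] by simp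
  qed
  with f'(2) show "\<exists>f'. (\<forall>x. (f has_real_derivative f' x) (at x)) \<and> Ck_on k UNIV f'"
    by (intro exI[of _ "\<lambda>x. f' x 1"]) auto
next
  assume "\<exists>f'. (\<forall>x. (f has_real_derivative f' x) (at x)) \<and> Ck_on k UNIV f'"
  then obtain f' where f': "\<And>x. (f has_real_derivative f' x) (at x)" "Ck_on k UNIV f'"
    by blast
  have "continuous_on UNIV f"
    using f'(1) DERIV_continuous_on by blast
  moreover have "\<exists>f'. (\<forall>x\<in>UNIV. (f has_derivative f' x) (at x within UNIV)) \<and>
           (\<forall>b\<in>Basis. Ck_on k UNIV (\<lambda>x. f' x b))"
    using f' by (intro exI[of _ "\<lambda>x h. f' x * h"]) (auto simp: has_field_derivative_def)
  ultimately show "Ck_on (Suc k) UNIV f" by simp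
qed

lemma Ck_on_SucD: "Ck_on (Suc k) S f \<Longrightarrow> Ck_on k S f"
proof (induction k arbitrary: f)
  case (Suc k)
  then show ?case by (metis Ck_on.simps(2))
qed simp

lemma Ck_on_add_real:
  fixes f g :: "real \<Rightarrow> real"
  shows "Ck_on k UNIV f \<Longrightarrow> Ck_on k UNIV g \<Longrightarrow> Ck_on k UNIV (\<lambda>x. f x + g x)"
proof (induction k arbitrary: f g)
  case 0
  then show ?case by (auto intro: continuous_on_add)
next
  case (Suc k)
  then show ?case
    unfolding Ck_on_Suc_real by (fastforce intro: DERIV_add)
qed

lemma Ck_on_mult_real:
  fixes f g :: "real \<Rightarrow> real"
  shows "Ck_on k UNIV f \<Longrightarrow> Ck_on k UNIV g \<Longrightarrow> Ck_on k UNIV (\<lambda>x. f x * g x)"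
proof (induction k arbitrary: f g)
  case 0
  then show ?case by (auto intro: continuous_on_mult)
next
  case (Suc k)
  have "Ck_on k UNIV f" "Ck_on k UNIV g" using Suc.prems Ck_on_SucD by blast+
  moreover obtain f' g' where "\<And>x. (f has_real_derivative f' x) (at x)" "Ck_on k UNIV f'"
     "\<And>x. (g has_real_derivative g' x) (at x)" "Ck_on k UNIV g'"
    using Suc.prems unfolding Ck_on_Suc_real by auto
  ultimately show ?case
    unfolding Ck_on_Suc_real
    by (intro exI[of _ "\<lambda>x. f' x * g x + g' x * f x"])
      (auto intro!: DERIV_mult Ck_on_add_real Suc.IH)
qed

lemma Ck_on_const_real: "Ck_on k UNIV (\<lambda>x::real. c)"
proof (induction k arbitrary: c)
  case (Suc k)
  show ?case unfolding Ck_on_Suc_real by (rule exI[of _ "\<lambda>x. 0"]) (use Suc in auto)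
qed auto

lemma Ck_on_affine_real:
  fixes f :: "real \<Rightarrow> real"
  shows "Ck_on k UNIV f \<Longrightarrow> Ck_on k UNIV (\<lambda>x. f (m * x + c))"
proof (induction k arbitrary: f)
  case 0
  then show ?case
    by (auto intro!: continuous_on_compose2[OF 0[simplified]] continuous_intros)
next
  case (Suc k)
  then obtain f' where f': "\<And>x. (f has_real_derivative f' x) (at x)" "Ck_on k UNIV f'"
    unfolding Ck_on_Suc_real by auto
  have "((\<lambda>x. f (m * x + c)) has_real_derivative f' (m * x + c) * m) (at x)" for x
    by (rule DERIV_chain2[OF f'(1)]) (auto intro!: derivative_eq_intros)
  moreover have "Ck_on k UNIV (\<lambda>x. f' (m * x + c) * m)"
    by (intro Ck_on_mult_real Ck_on_const_real Suc.IH f')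
  ultimately show ?case
    unfolding Ck_on_Suc_real by (intro exI[of _ "\<lambda>x. f' (m * x + c) * m"]) auto
qed

text \<open>The polynomial factor makes the family of these functions closed under differentiation.\<close>

definition flat_exp :: "real \<Rightarrow> real poly \<Rightarrow> real \<Rightarrow> real" where
  "flat_exp c P x = (if x > 0 then poly P (1 / x) * exp (- c / x) else 0)"

text \<open>With y = 1 / x this expresses that \<open>flat_exp c P\<close> is flat at 0 from the
  right: the exponential beats every power, monomial by monomial.\<close>

lemma poly_mult_exp_tendsto_0:
  fixes c :: real
  assumes "c > 0"
  shows "((\<lambda>y. poly P y * exp (- c * y)) \<longlongrightarrow> 0) at_top"
proof -
  have mono: "((\<lambda>y. a * y ^ k * exp (- c * y)) \<longlongrightarrow> 0) at_top" for k and a :: real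
  proof -
    have "((\<lambda>y. a / c ^ k * ((c * y) ^ k / exp (c * y))) \<longlongrightarrow> a / c ^ k * 0) at_top"
      by (intro tendsto_mult tendsto_const filterlim_compose[OF tendsto_power_div_exp_0]
          filterlim_tendsto_pos_mult_at_top[OF tendsto_const assms] filterlim_ident)
    moreover have "a / c ^ k * ((c * y) ^ k / exp (c * y)) = a * y ^ k * exp (- c * y)" for y
      using assms by (simp add: exp_minus field_simps power_mult_distrib)
    ultimately show ?thesis by simp
  qed
  have "((\<lambda>y. \<Sum>i\<le>degree P. coeff P i * y ^ i * exp (- c * y)) \<longlongrightarrow> (\<Sum>i\<le>degree P. 0)) at_top"
    by (intro tendsto_sum mono)
  then show ?thesis by (simp add: poly_altdef sum_distrib_right)
qed

text \<open>For x > 0 the chain rule gives (1/x)^2 * (c * P(1/x) - P'(1/x)) * exp(-c/x), so the new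
  polynomial is y^2 * (c * P - P'); \<open>[:0, 0, 1:]\<close> is y^2. The only delicate point is x
  = 0, where the difference quotients are examined from both sides.\<close>

lemma flat_exp_has_derivative:
  assumes "c > 0"
  shows "(flat_exp c P has_real_derivative flat_exp c ([:0, 0, 1:] * (smult c P - pderiv P)) x) (at x)"
proof -
  consider "x > 0" | "x < 0" | "x = 0" by linarith
  then show ?thesis
  proof cases
    case 1
    have "((\<lambda>x. poly P (1 / x) * exp (- c / x)) has_real_derivative
        flat_exp c ([:0, 0, 1:] * (smult c P - pderiv P)) x) (at x)"
      using 1 by (auto intro!: derivative_eq_intros DERIV_chain2[OF poly_DERIV]
          simp: flat_exp_def field_simps power2_eq_square)
    then show ?thesis
      by (rule has_field_derivative_transform_within_open[of _ _ _ "{0<..}"])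
        (use 1 in \<open>auto simp: flat_exp_def\<close>)
  next
    case 2
    have "((\<lambda>x. 0) has_real_derivative 0) (at x)" by simp
    then have "(flat_exp c P has_real_derivative 0) (at x)"
      by (rule has_field_derivative_transform_within_open[of _ _ _ "{..<0}"])
        (use 2 in \<open>auto simp: flat_exp_def\<close>)
    with 2 show ?thesis by (simp add: flat_exp_def)
  next
    case 3
    have "((\<lambda>h. flat_exp c P h / h) \<longlongrightarrow> 0) (at_right 0)"
    proof (rule Lim_transform_eventually)
      \<comment> \<open>Dividing by h multiplies by y = 1 / h, and \<open>pCons 0 P\<close> is the
        polynomial y * P(y), so the difference quotient has the form covered by the decay
        lemma.\<close>
      show "((\<lambda>h. poly (pCons 0 P) (inverse h) * exp (- c * inverse h)) \<longlongrightarrow> 0) (at_right 0)"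
        by (rule filterlim_compose[OF poly_mult_exp_tendsto_0[OF assms] filterlim_inverse_at_top_right])
      show "\<forall>\<^sub>F h in at_right 0. poly (pCons 0 P) (inverse h) * exp (- c * inverse h) = flat_exp c P h / h"
        by (auto simp: eventually_at_right_field flat_exp_def field_simps intro!: exI[of _ 1])
    qed
    moreover have "((\<lambda>h. flat_exp c P h / h) \<longlongrightarrow> 0) (at_left 0)"
      by (rule tendsto_eventually) (auto simp: eventually_at_left_field flat_exp_def intro!: exI[of _ "-1"])
    ultimately have "((\<lambda>h. flat_exp c P h / h) \<longlongrightarrow> 0) (at 0)"
      using filterlim_split_at by blast
    with 3 show ?thesis by (simp add: DERIV_def flat_exp_def)
  qed
qed

lemma Ck_on_flat_exp:
  assumes "c > 0"
  shows "Ck_on k UNIV (flat_exp c P)"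
proof (induction k arbitrary: P)
  case 0
  show ?case
    using flat_exp_has_derivative[OF assms] DERIV_continuous_on by (metis Ck_on.simps(1))
next
  case (Suc k)
  then show ?case
    using flat_exp_has_derivative[OF assms] unfolding Ck_on_Suc_real by blast
qed

text \<open>The constant \<open>1 / Suc n\<close> is positive, which makes the factors smooth, and
  tends to 0, which makes them tend to 1 inside the interval. The function vanishes outside
  \<open>{p<..<q}\<close>, so \<open>{p..q}\<close> serves as the compact set demanded of a test
  function.\<close>

definition cutoff :: "real \<Rightarrow> real \<Rightarrow> nat \<Rightarrow> real \<Rightarrow> real" where
  "cutoff p q n x = flat_exp (1 / Suc n) 1 (x - p) * flat_exp (1 / Suc n) 1 (q - x)"

lemma Ck_on_cutoff: "Ck_on k UNIV (cutoff p q n)"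
proof -
  have "Ck_on k UNIV (\<lambda>x. flat_exp (1 / Suc n) 1 (1 * x + - p) * flat_exp (1 / Suc n) 1 (- 1 * x + q))"
    by (intro Ck_on_mult_real Ck_on_affine_real Ck_on_flat_exp) auto
  then show ?thesis by (simp add: cutoff_def[abs_def])
qed

lemma flat_exp_1_bounds: "c \<ge> 0 \<Longrightarrow> 0 \<le> flat_exp c 1 x \<and> flat_exp c 1 x \<le> 1"
  by (auto simp: flat_exp_def)

lemma cutoff_bounds: "0 \<le> cutoff p q n x" "cutoff p q n x \<le> 1"
  unfolding cutoff_def using flat_exp_1_bounds[of "1 / Suc n"] by (auto intro: mult_le_one)

lemma cutoff_eq_0: "x \<notin> {p<..<q} \<Longrightarrow> cutoff p q n x = 0"
  by (auto simp: cutoff_def flat_exp_def)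

lemma cutoff_tendsto_1:
  assumes "x \<in> {p<..<q}"
  shows "(\<lambda>n. cutoff p q n x) \<longlonglongrightarrow> 1"
proof -
  have "(\<lambda>n. exp (- (1 / real (Suc n)) / (x - p)) * exp (- (1 / real (Suc n)) / (q - x))) \<longlonglongrightarrow>
      exp (- 0 / (x - p)) * exp (- 0 / (q - x))"
    using assms by (intro tendsto_intros LIMSEQ_Suc lim_1_over_n) auto
  then show ?thesis
    using assms by (simp add: cutoff_def flat_exp_def)
qed

text \<open>One factor increases, the other decreases, and both take values in [0,1]. By the product
  rule the variation is at most the sum of the two variations, hence at most 1 + 1. The bound is
  uniform in \<open>n\<close>, although the derivatives themselves blow up near the endpoints as
  \<open>n\<close> grows.\<close>

lemma cutoff_variation:
  assumes "p < q"
  obtains c' where "\<And>x. (cutoff p q n has_real_derivative c' x) (at x)" "continuous_on UNIV c'"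
    "integral {p..q} (\<lambda>x. \<bar>c' x\<bar>) \<le> 2" "\<And>x. x \<notin> {p..q} \<Longrightarrow> c' x = 0"
proof -
  define E where "E = flat_exp (1 / Suc n) 1"
  define E' where "E' = flat_exp (1 / Suc n) ([:0, 0, 1:] * (smult (1 / Suc n) 1 - pderiv 1))"
  have dE: "(E has_real_derivative E' x) (at x)" for x
    unfolding E_def E'_def by (rule flat_exp_has_derivative) simp
  have E'0: "E' x \<ge> 0" for x
    by (auto simp: E'_def flat_exp_def)
  have E01: "0 \<le> E x" "E x \<le> 1" for x
    unfolding E_def using flat_exp_1_bounds[of "1 / Suc n" x] by auto
  have cE': "continuous_on A E'" for A
    using Ck_on_flat_exp[of "1 / Suc n" 0] continuous_on_subset unfolding E'_def by (simp, blast)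
  have cE: "continuous_on A E" for A
    using dE DERIV_continuous_on continuous_on_subset by blast
  define c' where "c' = (\<lambda>x. E' (x - p) * E (q - x) - E' (q - x) * E (x - p))"
  have d1: "((\<lambda>x. E (x - p)) has_real_derivative E' (x - p) * 1) (at x)" for x
    by (rule DERIV_chain2[OF dE]) (auto intro!: derivative_eq_intros)
  have d2: "((\<lambda>x. E (q - x)) has_real_derivative E' (q - x) * (- 1)) (at x)" for x
    by (rule DERIV_chain2[OF dE]) (auto intro!: derivative_eq_intros)
  have "((\<lambda>x. E (x - p) * E (q - x)) has_real_derivative c' x) (at x)" for x
    using DERIV_mult[OF d1[of x] d2[of x]] by (simp add: c'_def algebra_simps)
  then have 1: "(cutoff p q n has_real_derivative c' x) (at x)" for x
    unfolding cutoff_def[abs_def] E_def .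
  have 2: "continuous_on UNIV c'"
    unfolding c'_def
    by (intro continuous_intros continuous_on_compose2[OF cE'] continuous_on_compose2[OF cE]) auto
  have i1: "((\<lambda>x. E' (x - p)) has_integral E (q - p) - E 0) {p..q}"
    using assms d1 fundamental_theorem_of_calculus[of p q "\<lambda>x. E (x - p)" "\<lambda>x. E' (x - p)"]
    by (auto simp: has_real_derivative_iff_has_vector_derivative[symmetric]
        intro: has_field_derivative_at_within)
  have i2: "((\<lambda>x. - E' (q - x)) has_integral E 0 - E (q - p)) {p..q}"
    using assms d2 fundamental_theorem_of_calculus[of p q "\<lambda>x. E (q - x)" "\<lambda>x. - E' (q - x)"]
    by (auto simp: has_real_derivative_iff_has_vector_derivative[symmetric]
        intro: has_field_derivative_at_within)
  have "((\<lambda>x. E' (x - p) - (- E' (q - x))) has_integral (E (q - p) - E 0) - (E 0 - E (q - p))) {p..q}"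
    by (intro has_integral_diff i1 i2)
  moreover have "((\<lambda>x. \<bar>c' x\<bar>) has_integral integral {p..q} (\<lambda>x. \<bar>c' x\<bar>)) {p..q}"
    by (intro integrable_integral integrable_continuous_interval continuous_on_rabs
        continuous_on_subset[OF 2]) auto
  moreover have "\<bar>c' x\<bar> \<le> E' (x - p) - (- E' (q - x))" for x
  proof -
    have "\<bar>c' x\<bar> \<le> \<bar>E' (x - p) * E (q - x)\<bar> + \<bar>E' (q - x) * E (x - p)\<bar>"
      unfolding c'_def by (rule abs_triangle_ineq4)
    also have "\<dots> = E' (x - p) * E (q - x) + E' (q - x) * E (x - p)"
      using E'0 E01 by simp
    also have "\<dots> \<le> E' (x - p) * 1 + E' (q - x) * 1"
      using E'0 E01 by (intro add_mono mult_left_mono) auto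
    finally show ?thesis by simp
  qed
  ultimately have "integral {p..q} (\<lambda>x. \<bar>c' x\<bar>) \<le> (E (q - p) - E 0) - (E 0 - E (q - p))"
    by (meson has_integral_le)
  also have "\<dots> \<le> 2" using E01[of "q - p"] E01[of 0] by linarith
  finally have 3: "integral {p..q} (\<lambda>x. \<bar>c' x\<bar>) \<le> 2" .
  have "c' x = 0" if "x \<notin> {p..q}" for x
    using that by (auto simp: c'_def E_def E'_def flat_exp_def)
  with 1 2 3 show ?thesis by (rule that)
qed

section \<open>Weak derivatives in one dimension\<close>

lemma integrable_lebesgue_on_subset:
  fixes f :: "'a::euclidean_space \<Rightarrow> real"
  assumes "integrable (lebesgue_on T) f" "S \<subseteq> T" "S \<in> sets lebesgue" "T \<in> sets lebesgue"
  shows "integrable (lebesgue_on S) f"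
  using assms set_integrable_subset[of lebesgue T f S]
  by (simp add: integrable_restrict_space set_integrable_def)

lemma integrable_mult_continuous:
  fixes f g :: "real \<Rightarrow> real"
  assumes "integrable (lebesgue_on K) f" "compact K" "continuous_on K g"
  shows "integrable (lebesgue_on K) (\<lambda>x. f x * g x)"
proof -
  have K: "K \<in> sets lebesgue" using assms by (simp add: lmeasurable_compact fmeasurableD)
  have "(\<lambda>x. g x * f x) absolutely_integrable_on K"
    using assms K
    by (intro absolutely_integrable_bounded_measurable_product_real
        continuous_imp_measurable_on_sets_lebesgue compact_imp_bounded compact_continuous_image)
      (auto simp: integrable_restrict_space set_integrable_def)
  with K show ?thesis
    by (simp add: integrable_restrict_space set_integrable_def mult.commute)
qed

lemma integrable_lebesgue_on_continuous:
  fixes f :: "real \<Rightarrow> real"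
  assumes "compact K" "continuous_on K f"
  shows "integrable (lebesgue_on K) f"
proof -
  have "integrable (lebesgue_on K) (\<lambda>x. 1 :: real)"
    using finite_measure.integrable_const[OF finite_measure_lebesgue_on[OF lmeasurable_compact[OF assms(1)]]] .
  from integrable_mult_continuous[OF this assms] show ?thesis by simp
qed

section \<open>Functions determined almost everywhere by their integrals\<close>

lemma AE_lebesgue_neq: "AE x in lebesgue. x \<noteq> (a::real)"
  by (rule AE_completion) (rule AE_lborel_singleton)

text \<open>The positive and negative parts of \<open>f\<close> are densities of two finite measures
  that agree on all rays. Rays determine such measures, and densities are unique almost everywhere,
  so the two parts coincide and \<open>f\<close> vanishes.\<close>

lemma AE_eq_0_if_ray_integrals_eq_0:
  fixes f :: "real \<Rightarrow> real"
  assumes int: "integrable lebesgue f" and ray: "\<And>x. (LINT y:{x..}|lebesgue. f y) = 0"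
  shows "AE x in lebesgue. f x = 0"
proof -
  \<comment> \<open>The comparison of measures takes place on Borel sets, so \<open>f\<close> is
    replaced by a Borel representative.\<close>
  obtain f' where f'[measurable]: "f' \<in> borel_measurable lborel" and ae: "AE x in lborel. f x = f' x"
    using completion_ex_borel_measurable_real[of f lborel] int by blast
  have ae': "AE x in lebesgue. f x = f' x" using ae by (rule AE_completion)
  have m[measurable]: "f' \<in> borel_measurable lebesgue"
    using f' by (rule measurable_completion)
  have fm[measurable]: "f \<in> borel_measurable lebesgue" using int by blast
  have "integrable lebesgue f'"
    using integrable_cong_AE[OF fm m ae'] int by blast
  then have int': "integrable lborel f'"
    using integrable_completion[OF f'] by blast
  \<comment> \<open>Uniqueness of measures on the line is available for open rays; passing from
    closed to open rays changes only one point.\<close>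
  have ray': "(LINT y|lborel. f' y * indicator {x<..} y) = 0" for x
  proof -
    have "(LINT y|lborel. f' y * indicator {x<..} y) = (LINT y|lebesgue. f' y * indicator {x<..} y)"
      by (rule integral_completion[symmetric]) measurable
    also have "\<dots> = (LINT y:{x..}|lebesgue. f y)"
      unfolding set_lebesgue_integral_def
    proof (rule integral_cong_AE)
      show "AE y in lebesgue. f' y * indicator {x<..} y = indicator {x..} y *\<^sub>R f y"
        using ae' AE_lebesgue_neq[of x] by eventually_elim (auto simp: indicator_def)
    qed (intro borel_measurable_times borel_measurable_scaleR borel_measurable_indicator m fm; simp)+
    finally show ?thesis using ray by simp
  qed
  have intx: "integrable lborel (\<lambda>y. f' y * indicator {x<..} y)" for x
    by (rule integrable_real_mult_indicator) (use int' in auto)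
  have fin: "(\<integral>\<^sup>+ y. ennreal (f' y * indicator {x<..} y) \<partial>lborel) < top"
    "(\<integral>\<^sup>+ y. ennreal (- (f' y * indicator {x<..} y)) \<partial>lborel) < top" for x
    using intx[of x] by (simp_all add: real_integrable_def less_top)
  have eq: "(\<integral>\<^sup>+ y. ennreal (f' y * indicator {x<..} y) \<partial>lborel) =
      (\<integral>\<^sup>+ y. ennreal (- (f' y * indicator {x<..} y)) \<partial>lborel)" for x
  proof -
    have "enn2real (\<integral>\<^sup>+ y. ennreal (f' y * indicator {x<..} y) \<partial>lborel) =
        enn2real (\<integral>\<^sup>+ y. ennreal (- (f' y * indicator {x<..} y)) \<partial>lborel)"
      using real_lebesgue_integral_def[OF intx[of x]] ray'[of x] by simp
    from arg_cong[OF this, of ennreal] show ?thesis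
      by (simp only: ennreal_enn2real[OF fin(1)] ennreal_enn2real[OF fin(2)])
  qed
  have ind: "ennreal (s * indicator A y) = ennreal s * indicator A y" for s :: real and A :: "real set" and y
    by (auto simp: indicator_def)
  \<comment> \<open>\<open>ennreal\<close> sends negative numbers to 0, so these two densities are
    the positive and the negative part of \<open>f'\<close>. At each point one of them is 0, and
    equality forces both to be 0.\<close>
  have "density lborel (\<lambda>x. ennreal (f' x)) = density lborel (\<lambda>x. ennreal (- f' x))"
    using fin eq unfolding mult_minus_left[symmetric] ind
    by (intro measure_eqI_lessThan) (auto simp: emeasure_density)
  then have "AE x in lborel. ennreal (f' x) = ennreal (- f' x)"
    by (rule sigma_finite_measure.density_unique[OF lborel.sigma_finite_measure_axioms, rotated 2]) auto
  then have "AE x in lborel. f' x = 0"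
    by eventually_elim (smt (verit) ennreal_eq_0_iff ennreal_neg)
  then show ?thesis
    using AE_completion[of "\<lambda>x. f' x = 0" lborel] ae' by auto
qed

text \<open>Extending \<open>f\<close> by zero turns the integral over the ray from \<open>x\<close>
  into one over \<open>{max x a..b}\<close>; this is why intervals with the fixed right end
  \<open>b\<close> suffice.\<close>

lemma AE_eq_0_if_interval_integrals_eq_0:
  fixes f :: "real \<Rightarrow> real"
  assumes int: "integrable (lebesgue_on {a..b}) f"
    and 0: "\<And>p. a \<le> p \<Longrightarrow> p < b \<Longrightarrow> (LINT x|lebesgue_on {p..b}. f x) = 0"
  shows "AE x in lebesgue. x \<in> {a..b} \<longrightarrow> f x = 0"
proof -
  define F where "F = (\<lambda>x. if x \<in> {a..b} then f x else 0)"
  have "integrable lebesgue F"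
    unfolding F_def by (rule Lebesgue_Measure.integrable_restrict_UNIV[THEN iffD2, OF _ int]) simp
  moreover have "(LINT y:{x..}|lebesgue. F y) = 0" for x
  proof -
    have "(LINT y:{x..}|lebesgue. F y) = (LINT y|lebesgue. (if y \<in> {max x a..b} then f y else 0))"
      unfolding set_lebesgue_integral_def F_def
      by (rule Bochner_Integration.integral_cong) (auto simp: indicator_def)
    also have "\<dots> = (LINT y|lebesgue_on {max x a..b}. f y)"
      by (rule Lebesgue_Measure.integral_restrict_UNIV) auto
    also have "\<dots> = 0"
    proof (cases "max x a < b")
      case False
      then have "{max x a..b} \<in> null_sets lebesgue"
        by (cases "max x a = b") (auto simp: null_sets_completionI)
      then show ?thesis by (rule integral_eq_zero_null_sets)
    qed (use 0 in auto)
    finally show ?thesis .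
  qed
  ultimately have "AE x in lebesgue. F x = 0"
    by (rule AE_eq_0_if_ray_integrals_eq_0)
  then show ?thesis by eventually_elim (auto simp: F_def)
qed

section \<open>Limits of integrals against cutoffs and their derivatives\<close>

lemma integral_mult_cutoff_tendsto:
  assumes "integrable (lebesgue_on {p..q}) h"
  shows "(\<lambda>n. LINT x|lebesgue_on {p..q}. h x * cutoff p q n x) \<longlonglongrightarrow> (LINT x|lebesgue_on {p..q}. h x)"
proof (rule integral_dominated_convergence[where w = "\<lambda>x. \<bar>h x\<bar>"])
  have "AE x in lebesgue_on {p..q}. x \<noteq> p \<and> x \<noteq> q"
    using AE_lebesgue_neq[of p] AE_lebesgue_neq[of q] by (auto simp: AE_restrict_space_iff)
  \<comment> \<open>The cutoffs are 0 at \<open>p\<close> and \<open>q\<close> for every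
    \<open>n\<close>, so pointwise convergence holds only off the endpoints.\<close>
  then have "AE x in lebesgue_on {p..q}. x \<in> {p<..<q}"
    by (rule lebesgue_on_mono) auto
  then show "AE x in lebesgue_on {p..q}. (\<lambda>n. h x * cutoff p q n x) \<longlonglongrightarrow> h x"
  proof eventually_elim
    case (elim x)
    show ?case using tendsto_mult[OF tendsto_const[of "h x"] cutoff_tendsto_1[OF elim]] by simp
  qed
  show "(\<lambda>x. h x * cutoff p q n x) \<in> borel_measurable (lebesgue_on {p..q})" for n
    using borel_measurable_integrable[OF integrable_mult_continuous[OF assms, of "cutoff p q n"]]
      Ck_on_cutoff[of 0 p q n] continuous_on_subset by auto
  show "AE x in lebesgue_on {p..q}. norm (h x * cutoff p q n x) \<le> \<bar>h x\<bar>" for n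
    using cutoff_bounds[of p q n] by (auto simp: abs_mult intro!: mult_left_le)
qed (use assms in auto)

text \<open>
  Integration by parts proves this for polynomial \<open>F\<close>; the uniform bound on the total variation
  of the cutoffs extends it to continuous \<open>F\<close>.
\<close>

lemma integral_mult_cutoff_deriv_tendsto:
  fixes c' :: "nat \<Rightarrow> real \<Rightarrow> real"
  assumes pq: "p < q" and F: "continuous_on {p..q} F"
    and d: "\<And>n x. (cutoff p q n has_real_derivative c' n x) (at x)"
    and c: "\<And>n. continuous_on UNIV (c' n)"
    and var: "\<And>n. integral {p..q} (\<lambda>x. \<bar>c' n x\<bar>) \<le> 2"
  shows "(\<lambda>n. integral {p..q} (\<lambda>x. F x * c' n x)) \<longlonglongrightarrow> F p - F q"
proof (rule LIMSEQ_I)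
  fix r :: real assume r: "r > 0"
  \<comment> \<open>The total error stays below r: the approximation costs r/8 times the variation 2
    in the integral and r/8 at each endpoint, and the limit for \<open>P\<close> contributes r/4,
    altogether 3r/4.\<close>
  obtain P where P: "real_polynomial_function P" and FP: "\<And>x. x \<in> {p..q} \<Longrightarrow> \<bar>F x - P x\<bar> < r / 8"
    using Stone_Weierstrass_real_polynomial_function[OF compact_Icc F, of "r / 8"] r by auto
  obtain P' where P': "real_polynomial_function P'" "\<And>x. (P has_real_derivative P' x) (at x)"
    using has_real_derivative_polynomial_function[OF P] by blast
  have cc: "continuous_on A (c' n)" for A n using c continuous_on_subset by blast
  have cP: "continuous_on A P" for A
    using P'(2) DERIV_continuous_on continuous_on_subset by blast
  have cP': "continuous_on A P'" for A
    using has_real_derivative_polynomial_function[OF P'(1)] DERIV_continuous_on continuous_on_subset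
    by (metis subset_UNIV)
  have cut: "continuous_on A (cutoff p q n)" for A n
    using d DERIV_continuous_on continuous_on_subset by blast
  have byparts: "integral {p..q} (\<lambda>x. P x * c' n x) = - (LINT x|lebesgue_on {p..q}. P' x * cutoff p q n x)" for n
  proof -
    have "((\<lambda>x. P' x * cutoff p q n x + c' n x * P x) has_integral
        P q * cutoff p q n q - P p * cutoff p q n p) {p..q}"
      using pq DERIV_mult[OF P'(2) d]
      by (intro fundamental_theorem_of_calculus)
        (auto simp: has_real_derivative_iff_has_vector_derivative[symmetric] intro: has_field_derivative_at_within)
    \<comment> \<open>The boundary terms drop out because the cutoff is 0 at both endpoints.\<close>
    then have "integral {p..q} (\<lambda>x. P' x * cutoff p q n x + c' n x * P x) = 0"
      by (auto simp: cutoff_eq_0 dest: integral_unique)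
    moreover have "integral {p..q} (\<lambda>x. P' x * cutoff p q n x + c' n x * P x) =
       integral {p..q} (\<lambda>x. P' x * cutoff p q n x) + integral {p..q} (\<lambda>x. c' n x * P x)"
      by (intro Henstock_Kurzweil_Integration.integral_add integrable_continuous_interval continuous_intros cc cP cP' cut)
    moreover have "(LINT x|lebesgue_on {p..q}. P' x * cutoff p q n x) = integral {p..q} (\<lambda>x. P' x * cutoff p q n x)"
      by (intro lebesgue_integral_eq_integral integrable_lebesgue_on_continuous continuous_intros cP' cut) auto
    ultimately show ?thesis by (simp add: mult.commute)
  qed
  have "(\<lambda>n. - (LINT x|lebesgue_on {p..q}. P' x * cutoff p q n x)) \<longlonglongrightarrow> - (LINT x|lebesgue_on {p..q}. P' x)"
    by (intro tendsto_minus integral_mult_cutoff_tendsto integrable_lebesgue_on_continuous cP') auto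
  moreover have "(LINT x|lebesgue_on {p..q}. P' x) = P q - P p"
  proof -
    have "(P' has_integral P q - P p) {p..q}"
      using pq P'(2)
      by (intro fundamental_theorem_of_calculus)
        (auto simp: has_real_derivative_iff_has_vector_derivative[symmetric] intro: has_field_derivative_at_within)
    then show ?thesis
      using lebesgue_integral_eq_integral[OF integrable_lebesgue_on_continuous[OF compact_Icc cP']]
      by (simp add: integral_unique)
  qed
  \<comment> \<open>In the limit the cutoff rises by 1 at \<open>p\<close> and falls by 1 at
    \<open>q\<close>: its derivative acts like a unit mass at \<open>p\<close> minus one at
    \<open>q\<close>, whence the sign.\<close>
  ultimately have "(\<lambda>n. integral {p..q} (\<lambda>x. P x * c' n x)) \<longlonglongrightarrow> P p - P q"
    by (simp add: byparts)
  from LIMSEQ_D[OF this, of "r / 4"] obtain N where N: "\<And>n. n \<ge> N \<Longrightarrow> \<bar>integral {p..q} (\<lambda>x. P x * c' n x) - (P p - P q)\<bar> < r / 4"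
    using r by auto
  have "norm (integral {p..q} (\<lambda>x. F x * c' n x) - (F p - F q)) < r" if "n \<ge> N" for n
  proof -
    have "\<bar>integral {p..q} (\<lambda>x. F x * c' n x) - integral {p..q} (\<lambda>x. P x * c' n x)\<bar>
        = \<bar>integral {p..q} (\<lambda>x. (F x - P x) * c' n x)\<bar>"
      by (subst Henstock_Kurzweil_Integration.integral_diff[symmetric])
        (auto intro!: integrable_continuous_interval continuous_intros cc cP F simp: algebra_simps)
    also have "\<dots> \<le> integral {p..q} (\<lambda>x. r / 8 * \<bar>c' n x\<bar>)"
      unfolding real_norm_def[symmetric]
    proof (intro integral_norm_bound_integral integrable_continuous_interval continuous_intros cc cP F)
      show "norm ((F x - P x) * c' n x) \<le> r / 8 * norm (c' n x)" if "x \<in> {p..q}" for x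
        unfolding norm_mult using FP[OF that] by (intro mult_right_mono) auto
    qed
    also have "\<dots> = r / 8 * integral {p..q} (\<lambda>x. \<bar>c' n x\<bar>)"
      by simp
    also have "\<dots> \<le> r / 8 * 2"
      using r var by (intro mult_left_mono) auto
    finally have "\<bar>integral {p..q} (\<lambda>x. F x * c' n x) - integral {p..q} (\<lambda>x. P x * c' n x)\<bar> \<le> r / 4"
      by simp
    moreover have "\<bar>F p - P p\<bar> < r / 8" "\<bar>F q - P q\<bar> < r / 8"
      using FP pq by auto
    ultimately show ?thesis using N[OF that] by (simp add: abs_if split: if_splits)
  qed
  then show "\<exists>N. \<forall>n\<ge>N. norm (integral {p..q} (\<lambda>x. F x * c' n x) - (F p - F q)) < r" by blast
qed

section \<open>Integration by parts and uniqueness for weak derivatives\<close>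

lemma test_function_derivative:
  fixes \<phi> :: "real \<Rightarrow> real"
  assumes "\<phi> \<in> test_functions U"
  obtains K \<phi>' where "compact K" "K \<subseteq> U" "\<And>x. x \<notin> K \<Longrightarrow> \<phi> x = 0" "\<And>x. x \<notin> K \<Longrightarrow> \<phi>' x = 0"
    "\<And>k. Ck_on k UNIV \<phi>" "\<And>x. (\<phi> has_real_derivative \<phi>' x) (at x)"
    "continuous_on UNIV \<phi>" "continuous_on UNIV \<phi>'" "partial UNIV 1 \<phi> = \<phi>'"
proof -
  from assms obtain K where K: "compact K" "K \<subseteq> U" "\<And>x. x \<notin> K \<Longrightarrow> \<phi> x = 0"
    and Ck: "\<And>k. Ck_on k UNIV \<phi>"
    by (auto simp: test_functions_def)
  obtain \<phi>' where d: "\<And>x. (\<phi> has_real_derivative \<phi>' x) (at x)" and c: "continuous_on UNIV \<phi>'"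
    using Ck[of "Suc 0"] unfolding Ck_on_Suc_real by auto
  have "\<phi>' x = 0" if "x \<notin> K" for x
  proof -
    \<comment> \<open>Since the complement of \<open>K\<close> is open, \<open>\<phi>\<close> is 0
      in a whole neighbourhood of \<open>x\<close>, and the derivative inherits the support.\<close>
    have "open (- K)" using K(1) by (simp add: compact_imp_closed open_Compl)
    have "((\<lambda>x. 0) has_real_derivative 0) (at x)" by simp
    then have "(\<phi> has_real_derivative 0) (at x)"
      by (rule has_field_derivative_transform_within_open[where S = "- K"])
        (use K that \<open>open (- K)\<close> in auto)
    with d show ?thesis by (rule DERIV_unique)
  qed
  moreover have "partial UNIV 1 \<phi> = \<phi>'"
  proof
    fix x
    have "(\<phi> has_derivative (*) (\<phi>' x)) (at x)"
      using d by (simp add: has_field_derivative_def)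
    then have "frechet_derivative \<phi> (at x) = (*) (\<phi>' x)"
      by (rule frechet_derivative_at[symmetric])
    then show "partial UNIV 1 \<phi> x = \<phi>' x" by (simp add: partial_def)
  qed
  moreover have "continuous_on UNIV \<phi>" using d DERIV_continuous_on by blast
  ultimately show ?thesis using that K Ck d c by blast
qed

lemma integral_lebesgue_on_support:
  fixes f :: "'a::euclidean_space \<Rightarrow> real"
  assumes "S \<subseteq> T" "S \<in> sets lebesgue" "T \<in> sets lebesgue" "\<And>x. x \<in> T - S \<Longrightarrow> f x = 0"
  shows "integral\<^sup>L (lebesgue_on T) f = integral\<^sup>L (lebesgue_on S) f"
proof -
  have "integral\<^sup>L (lebesgue_on T) f = integral\<^sup>L (lebesgue_on T) (\<lambda>x. if x \<in> S then f x else 0)"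
    by (rule Bochner_Integration.integral_cong) (use assms(4) in auto)
  with integral_restrict[OF assms(1-3)] show ?thesis by simp
qed

lemma integrable_lebesgue_on_support:
  fixes f :: "'a::euclidean_space \<Rightarrow> real"
  assumes "S \<subseteq> T" "S \<in> sets lebesgue" "T \<in> sets lebesgue" "\<And>x. x \<in> T - S \<Longrightarrow> f x = 0"
    and "integrable (lebesgue_on S) f"
  shows "integrable (lebesgue_on T) f"
proof -
  have "(\<lambda>x. indicator T x *\<^sub>R f x) = (\<lambda>x. indicator S x *\<^sub>R f x)"
    using assms(1,4) by (auto simp: indicator_def fun_eq_iff)
  with assms show ?thesis by (simp add: integrable_restrict_space)
qed

text \<open>Obtained by testing with \<open>\<lambda>x. \<phi> x * cutoff p q n x\<close> and letting \<open>n\<close> tend to infinity.\<close>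

lemma weak_integration_by_parts:
  fixes f g \<phi> \<phi>' :: "real \<Rightarrow> real"
  assumes weak: "has_weak_partial U 1 f g" and U: "U \<in> sets lebesgue" "{p..q} \<subseteq> U" and pq: "p < q"
    and f: "continuous_on {p..q} f"
    and Ck: "\<And>k. Ck_on k UNIV \<phi>" and d\<phi>: "\<And>x. (\<phi> has_real_derivative \<phi>' x) (at x)"
  shows "(LINT x|lebesgue_on {p..q}. f x * \<phi>' x) =
    f q * \<phi> q - f p * \<phi> p - (LINT x|lebesgue_on {p..q}. g x * \<phi> x)"
proof -
  obtain \<phi>'' where "\<And>x. (\<phi> has_real_derivative \<phi>'' x) (at x)" "continuous_on UNIV \<phi>''"
    using Ck[of "Suc 0"] unfolding Ck_on_Suc_real by auto
  moreover have "\<phi>'' = \<phi>'" using calculation(1) d\<phi> DERIV_unique by blast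
  ultimately have c\<phi>': "continuous_on A \<phi>'" for A using continuous_on_subset by blast
  have c\<phi>: "continuous_on A \<phi>" for A using d\<phi> DERIV_continuous_on continuous_on_subset by blast
  have "\<exists>c'. (\<forall>x. (cutoff p q n has_real_derivative c' x) (at x)) \<and> continuous_on UNIV c' \<and>
      integral {p..q} (\<lambda>x. \<bar>c' x\<bar>) \<le> 2 \<and> (\<forall>x. x \<notin> {p..q} \<longrightarrow> c' x = 0)" for n
    using cutoff_variation[OF pq, of n] by metis
  then obtain c' where d: "\<And>n x. (cutoff p q n has_real_derivative c' n x) (at x)"
    and c: "\<And>n. continuous_on UNIV (c' n)" and var: "\<And>n. integral {p..q} (\<lambda>x. \<bar>c' n x\<bar>) \<le> 2"
    and c0: "\<And>n x. x \<notin> {p..q} \<Longrightarrow> c' n x = 0"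
    by metis
  have cc: "continuous_on A (c' n)" for A n using c continuous_on_subset by blast
  have cut: "continuous_on A (cutoff p q n)" for A n
    using d DERIV_continuous_on continuous_on_subset by blast
  have cut0: "x \<notin> {p..q} \<Longrightarrow> cutoff p q n x = 0" for x n by (auto intro: cutoff_eq_0)
  have intg: "integrable (lebesgue_on {p..q}) g"
    using weak U by (auto simp: has_weak_partial_def L1_loc_def)
  have ig: "integrable (lebesgue_on {p..q}) (\<lambda>x. g x * \<phi> x)"
    by (intro integrable_mult_continuous intg c\<phi>) auto
  have if': "integrable (lebesgue_on {p..q}) (\<lambda>x. f x * \<phi>' x)"
    by (intro integrable_lebesgue_on_continuous continuous_intros f c\<phi>') auto
  have eq: "(LINT x|lebesgue_on {p..q}. f x * \<phi>' x * cutoff p q n x) + integral {p..q} (\<lambda>x. f x * \<phi> x * c' n x) =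
     - (LINT x|lebesgue_on {p..q}. g x * \<phi> x * cutoff p q n x)" for n
  proof -
    \<comment> \<open>\<open>\<phi>\<close> is smooth but not assumed to have compact support; the
      cutoff supplies the support \<open>{p..q}\<close>, a compact subset of \<open>U\<close>, and
      makes the product admissible.\<close>
    define \<psi> where "\<psi> = (\<lambda>x. \<phi> x * cutoff p q n x)"
    define \<psi>' where "\<psi>' = (\<lambda>x. \<phi>' x * cutoff p q n x + c' n x * \<phi> x)"
    have "\<psi> \<in> test_functions U"
      using U Ck_on_mult_real[OF Ck Ck_on_cutoff] cut0
      unfolding test_functions_def \<psi>_def by (auto intro!: exI[of _ "{p..q}"])
    moreover have "partial UNIV 1 \<psi> = \<psi>'"
    proof -
      obtain D where D: "\<And>x. (\<psi> has_real_derivative D x) (at x)" "partial UNIV 1 \<psi> = D"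
        using test_function_derivative[OF \<open>\<psi> \<in> test_functions U\<close>] by metis
      have "(\<psi> has_real_derivative \<psi>' x) (at x)" for x
        unfolding \<psi>_def \<psi>'_def by (rule DERIV_mult[OF d\<phi> d])
      then have "D x = \<psi>' x" for x using D(1) DERIV_unique by blast
      then show ?thesis using D(2) by auto
    qed
    ultimately have "(LINT x|lebesgue_on U. f x * \<psi>' x) = - (LINT x|lebesgue_on U. g x * \<psi> x)"
      using weak unfolding has_weak_partial_def by metis
    moreover have "(LINT x|lebesgue_on U. f x * \<psi>' x) = (LINT x|lebesgue_on {p..q}. f x * \<psi>' x)"
      by (rule integral_lebesgue_on_support) (use U c0 cut0 in \<open>auto simp: \<psi>'_def\<close>)
    moreover have "(LINT x|lebesgue_on U. g x * \<psi> x) = (LINT x|lebesgue_on {p..q}. g x * \<psi> x)"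
      by (rule integral_lebesgue_on_support) (use U cut0 in \<open>auto simp: \<psi>_def\<close>)
    moreover have "(LINT x|lebesgue_on {p..q}. f x * \<psi>' x) =
       (LINT x|lebesgue_on {p..q}. f x * \<phi>' x * cutoff p q n x) + (LINT x|lebesgue_on {p..q}. f x * \<phi> x * c' n x)"
      unfolding \<psi>'_def
      by (subst Bochner_Integration.integral_add[symmetric])
        (auto intro!: integrable_lebesgue_on_continuous continuous_intros f c\<phi> c\<phi>' cc cut simp: algebra_simps)
    moreover have "(LINT x|lebesgue_on {p..q}. f x * \<phi> x * c' n x) = integral {p..q} (\<lambda>x. f x * \<phi> x * c' n x)"
      by (intro lebesgue_integral_eq_integral integrable_lebesgue_on_continuous continuous_intros f c\<phi> cc) auto
    ultimately show ?thesis by (simp add: \<psi>_def mult.assoc)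
  qed
  \<comment> \<open>The first summand converges by domination. The second concentrates at the
    endpoints and yields the boundary values; here the continuity of \<open>f\<close> up to
    \<open>p\<close> and \<open>q\<close> enters.\<close>
  have "(\<lambda>n. (LINT x|lebesgue_on {p..q}. f x * \<phi>' x * cutoff p q n x) + integral {p..q} (\<lambda>x. f x * \<phi> x * c' n x))
    \<longlonglongrightarrow> (LINT x|lebesgue_on {p..q}. f x * \<phi>' x) + (f p * \<phi> p - f q * \<phi> q)"
    by (intro tendsto_add integral_mult_cutoff_tendsto if'
        integral_mult_cutoff_deriv_tendsto[of p q "\<lambda>x. f x * \<phi> x", OF pq _ d c var] continuous_intros f c\<phi>)
  moreover have "(\<lambda>n. - (LINT x|lebesgue_on {p..q}. g x * \<phi> x * cutoff p q n x)) \<longlonglongrightarrow>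
     - (LINT x|lebesgue_on {p..q}. g x * \<phi> x)"
    by (intro tendsto_minus integral_mult_cutoff_tendsto ig)
  ultimately have "(LINT x|lebesgue_on {p..q}. f x * \<phi>' x) + (f p * \<phi> p - f q * \<phi> q) =
     - (LINT x|lebesgue_on {p..q}. g x * \<phi> x)"
    unfolding eq by (rule LIMSEQ_unique)
  then show ?thesis by simp
qed

text \<open>The preceding formula with the constant 1 in place of the test function, which is
  allowed there because no compact support is required.\<close>

lemma weak_partial_FTC:
  fixes f g :: "real \<Rightarrow> real"
  assumes "has_weak_partial U 1 f g" "U \<in> sets lebesgue" "{p..q} \<subseteq> U" "p < q" "continuous_on {p..q} f"
  shows "(LINT x|lebesgue_on {p..q}. g x) = f q - f p"
  using weak_integration_by_parts[OF assms, of "\<lambda>x. 1" "\<lambda>x. 0"]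
  by (simp add: Ck_on_const_real)

text \<open>Both derivatives integrate to the same increments of the continuous function, so their
  difference has zero integral over every compact subinterval.\<close>

lemma weak_partial_unique_AE:
  fixes f g h :: "real \<Rightarrow> real"
  assumes g: "has_weak_partial {l<..<r} 1 f g" and h: "has_weak_partial {l<..<r} 1 f' h"
    and f: "continuous_on {l<..<r} f" and eq: "\<And>x. x \<in> {l<..<r} \<Longrightarrow> f x = f' x"
  shows "AE x in lebesgue_on {l<..<r}. g x = h x"
proof -
  have f': "continuous_on {l<..<r} f'"
    by (rule continuous_on_eq[OF f eq])
  have *: "AE x in lebesgue. x \<in> {a..b} \<longrightarrow> g x - h x = 0" if "l < a" "b < r" for a b
  proof (rule AE_eq_0_if_interval_integrals_eq_0)
    have sub: "{p..b} \<subseteq> {l<..<r}" if "a \<le> p" for p using that \<open>l < a\<close> \<open>b < r\<close> by auto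
    have int: "integrable (lebesgue_on {p..b}) g" "integrable (lebesgue_on {p..b}) h" if "a \<le> p" for p
      using g h sub[OF that] by (auto simp: has_weak_partial_def L1_loc_def)
    show "integrable (lebesgue_on {a..b}) (\<lambda>x. g x - h x)"
      using int by auto
    show "(LINT x|lebesgue_on {p..b}. g x - h x) = 0" if "a \<le> p" "p < b" for p
    proof -
      have "(LINT x|lebesgue_on {p..b}. g x) = f b - f p" "(LINT x|lebesgue_on {p..b}. h x) = f' b - f' p"
        using that weak_partial_FTC[OF g _ sub[OF that(1)] that(2)] weak_partial_FTC[OF h _ sub[OF that(1)] that(2)]
          continuous_on_subset[OF f sub[OF that(1)]] continuous_on_subset[OF f' sub[OF that(1)]] by auto
      moreover have "f b = f' b" "f p = f' p" using eq that \<open>l < a\<close> \<open>b < r\<close> by auto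
      ultimately show ?thesis
        using int[OF that(1)] by simp
    qed
  qed
  \<comment> \<open>Local integrability gives control on compact subintervals only, so the open
    interval is exhausted by countably many of them and the null sets are united.\<close>
  have "AE x in lebesgue. \<forall>n. x \<in> {l + 1 / Suc n..r - 1 / Suc n} \<longrightarrow> g x - h x = 0"
    unfolding AE_all_countable by (intro allI *) auto
  then have "AE x in lebesgue. x \<in> {l<..<r} \<longrightarrow> g x = h x"
  proof eventually_elim
    case (elim x)
    show ?case
    proof
      assume x: "x \<in> {l<..<r}"
      then obtain n where "1 / Suc n < min (x - l) (r - x)"
        using nat_approx_posE[of "min (x - l) (r - x)"] by auto
      with elim[rule_format, of n] show "g x = h x" by auto
    qed
  qed
  then show ?thesis by (simp add: AE_restrict_space_iff)
qed

section \<open>Operations that preserve weak derivatives\<close>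

lemma has_weak_partial_diff:
  fixes f1 f2 g1 g2 :: "real \<Rightarrow> real"
  assumes w1: "has_weak_partial U 1 f1 g1" and w2: "has_weak_partial U 1 f2 g2" and U: "U \<in> sets lebesgue"
  shows "has_weak_partial U 1 (\<lambda>x. f1 x - f2 x) (\<lambda>x. g1 x - g2 x)"
  unfolding has_weak_partial_def
proof (intro conjI ballI)
  have L1: "f1 \<in> L1_loc U" "f2 \<in> L1_loc U" "g1 \<in> L1_loc U" "g2 \<in> L1_loc U"
    using w1 w2 by (auto simp: has_weak_partial_def)
  then show "(\<lambda>x. f1 x - f2 x) \<in> L1_loc U" "(\<lambda>x. g1 x - g2 x) \<in> L1_loc U"
    by (auto simp: L1_loc_def)
  fix \<phi> :: "real \<Rightarrow> real" assume \<phi>: "\<phi> \<in> test_functions U"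
  obtain K \<phi>' where K: "compact K" "K \<subseteq> U" "\<And>x. x \<notin> K \<Longrightarrow> \<phi> x = 0" "\<And>x. x \<notin> K \<Longrightarrow> \<phi>' x = 0"
    and c: "continuous_on UNIV \<phi>" "continuous_on UNIV \<phi>'" and p: "partial UNIV 1 \<phi> = \<phi>'"
    using test_function_derivative[OF \<phi>] by metis
  \<comment> \<open>Locally integrable functions need not be integrable over \<open>U\<close>. The
    compact support \<open>K\<close> makes the products integrable, so that the integral may be
    split.\<close>
  have int: "integrable (lebesgue_on U) (\<lambda>x. k x * \<eta> x)"
    if "k \<in> L1_loc U" "continuous_on UNIV \<eta>" "\<And>x. x \<notin> K \<Longrightarrow> \<eta> x = 0" for k \<eta>
    using that K U
    by (intro integrable_lebesgue_on_support[of K U] integrable_mult_continuous continuous_on_subset[OF that(2)])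
      (auto simp: L1_loc_def lmeasurable_compact fmeasurableD)
  have "(LINT x|lebesgue_on U. f1 x * \<phi>' x) = - (LINT x|lebesgue_on U. g1 x * \<phi> x)"
    "(LINT x|lebesgue_on U. f2 x * \<phi>' x) = - (LINT x|lebesgue_on U. g2 x * \<phi> x)"
    using w1 w2 \<phi> p by (auto simp: has_weak_partial_def)
  then show "(LINT x|lebesgue_on U. (f1 x - f2 x) * partial UNIV 1 \<phi> x) =
      - (LINT x|lebesgue_on U. (g1 x - g2 x) * \<phi> x)"
    using L1 K c by (simp add: p left_diff_distrib int)
qed

text \<open>Truncation normally produces point masses at \<open>p\<close> and \<open>q\<close> in
  the derivative. They are the boundary terms of the integration by parts, and vanish because
  \<open>f\<close> is 0 at both points.\<close>

lemma has_weak_partial_restrict: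
  fixes f g :: "real \<Rightarrow> real"
  assumes weak: "has_weak_partial U 1 f g" and U: "U \<in> sets lebesgue" "{p..q} \<subseteq> U" and pq: "p < q"
    and f: "continuous_on {p..q} f" "f p = 0" "f q = 0"
  shows "has_weak_partial U 1 (\<lambda>x. if x \<in> {p..q} then f x else 0) (\<lambda>x. if x \<in> {p..q} then g x else 0)"
  unfolding has_weak_partial_def
proof (intro conjI ballI)
  have L1: "(\<lambda>x. if x \<in> {p..q} then k x else 0) \<in> L1_loc U" if "k \<in> L1_loc U" for k
    unfolding L1_loc_def
  proof (intro CollectI allI impI)
    fix K assume K: "compact K \<and> K \<subseteq> U"
    have "integrable (lebesgue_on (K \<inter> {p..q})) k"
      using that K compact_Int_closed[of K "{p..q}"] by (auto simp: L1_loc_def)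
    then have "integrable (lebesgue_on (K \<inter> {p..q})) (\<lambda>x. if x \<in> {p..q} then k x else 0)"
      by (rule Bochner_Integration.integrable_cong[OF refl, THEN iffD1, rotated]) auto
    then show "integrable (lebesgue_on K) (\<lambda>x. if x \<in> {p..q} then k x else 0)"
      using K by (intro integrable_lebesgue_on_support[of "K \<inter> {p..q}" K])
        (auto simp: lmeasurable_compact fmeasurableD)
  qed
  show "(\<lambda>x. if x \<in> {p..q} then f x else 0) \<in> L1_loc U" "(\<lambda>x. if x \<in> {p..q} then g x else 0) \<in> L1_loc U"
    using weak L1[of f] L1[of g] unfolding has_weak_partial_def by blast+
  fix \<phi> :: "real \<Rightarrow> real" assume \<phi>: "\<phi> \<in> test_functions U"
  obtain \<phi>' where Ck: "\<And>k. Ck_on k UNIV \<phi>" and d: "\<And>x. (\<phi> has_real_derivative \<phi>' x) (at x)"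
    and p: "partial UNIV 1 \<phi> = \<phi>'"
    using test_function_derivative[OF \<phi>] by metis
  have restr: "(LINT x|lebesgue_on U. (if x \<in> {p..q} then k x else 0) * \<eta> x) = (LINT x|lebesgue_on {p..q}. k x * \<eta> x)"
    for k \<eta> :: "real \<Rightarrow> real"
  proof -
    have "(LINT x|lebesgue_on U. (if x \<in> {p..q} then k x else 0) * \<eta> x) =
        (LINT x|lebesgue_on U. (if x \<in> {p..q} then k x * \<eta> x else 0))"
      by (rule Bochner_Integration.integral_cong) auto
    then show ?thesis using integral_restrict[OF U(2) _ U(1), of "\<lambda>x. k x * \<eta> x"] by simp
  qed
  show "(LINT x|lebesgue_on U. (if x \<in> {p..q} then f x else 0) * partial UNIV 1 \<phi> x) =
      - (LINT x|lebesgue_on U. (if x \<in> {p..q} then g x else 0) * \<phi> x)"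
    unfolding p restr using weak_integration_by_parts[OF weak U pq f(1) Ck d] f by simp
qed

text \<open>Classical integration by parts on the closed interval; a test function has its support
  inside the open interval and is 0 at \<open>l\<close> and \<open>r\<close>.\<close>

lemma C1_imp_has_weak_partial:
  fixes v v' :: "real \<Rightarrow> real"
  assumes lr: "l < r" and v': "continuous_on {l..r} v'"
    and d: "\<And>x. x \<in> {l..r} \<Longrightarrow> (v has_real_derivative v' x) (at x within {l..r})"
  shows "has_weak_partial {l<..<r} 1 v v'"
  unfolding has_weak_partial_def
proof (intro conjI ballI)
  have v: "continuous_on {l..r} v" using d DERIV_continuous_on by blast
  have L1: "k \<in> L1_loc {l<..<r}" if "continuous_on {l..r} k" for k
    using that unfolding L1_loc_def
    by (auto intro!: integrable_lebesgue_on_continuous continuous_on_subset[OF that])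
  from L1 v v' show "v \<in> L1_loc {l<..<r}" "v' \<in> L1_loc {l<..<r}" by auto
  fix \<phi> :: "real \<Rightarrow> real" assume \<phi>: "\<phi> \<in> test_functions {l<..<r}"
  obtain K \<phi>' where K: "K \<subseteq> {l<..<r}" "\<And>x. x \<notin> K \<Longrightarrow> \<phi> x = 0" "\<And>x. x \<notin> K \<Longrightarrow> \<phi>' x = 0"
    and d\<phi>: "\<And>x. (\<phi> has_real_derivative \<phi>' x) (at x)"
    and c: "continuous_on UNIV \<phi>" "continuous_on UNIV \<phi>'" and p: "partial UNIV 1 \<phi> = \<phi>'"
    using test_function_derivative[OF \<phi>] by metis
  have c': "continuous_on A \<phi>" "continuous_on A \<phi>'" for A using c continuous_on_subset by blast+
  have "l \<notin> K" "r \<notin> K" using K(1) by auto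
  then have z: "\<phi> l = 0" "\<phi> r = 0" "\<phi>' l = 0" "\<phi>' r = 0" using K by auto
  have closed: "(LINT x|lebesgue_on {l<..<r}. k x * \<eta> x) = integral {l..r} (\<lambda>x. k x * \<eta> x)"
    if "continuous_on {l..r} k" "continuous_on {l..r} \<eta>" "\<eta> l = 0" "\<eta> r = 0" for k \<eta> :: "real \<Rightarrow> real"
  proof -
    have "(LINT x|lebesgue_on {l..r}. k x * \<eta> x) = (LINT x|lebesgue_on {l<..<r}. k x * \<eta> x)"
    proof (rule integral_lebesgue_on_support)
      show "k x * \<eta> x = 0" if "x \<in> {l..r} - {l<..<r}" for x
      proof -
        have "x = l \<or> x = r" using that by auto
        with \<open>\<eta> l = 0\<close> \<open>\<eta> r = 0\<close> show ?thesis by auto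
      qed
    qed auto
    moreover have "(LINT x|lebesgue_on {l..r}. k x * \<eta> x) = integral {l..r} (\<lambda>x. k x * \<eta> x)"
      using that
      by (intro lebesgue_integral_eq_integral integrable_lebesgue_on_continuous continuous_intros) auto
    ultimately show ?thesis by simp
  qed
  have "((\<lambda>x. v' x * \<phi> x + \<phi>' x * v x) has_integral v r * \<phi> r - v l * \<phi> l) {l..r}"
    using lr DERIV_mult[OF d has_field_derivative_at_within[OF d\<phi>]]
    by (intro fundamental_theorem_of_calculus)
      (auto simp: has_real_derivative_iff_has_vector_derivative[symmetric])
  then have "integral {l..r} (\<lambda>x. v' x * \<phi> x + \<phi>' x * v x) = 0"
    using z by (auto dest: integral_unique)
  moreover have "integral {l..r} (\<lambda>x. v' x * \<phi> x + \<phi>' x * v x) =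
      integral {l..r} (\<lambda>x. v' x * \<phi> x) + integral {l..r} (\<lambda>x. \<phi>' x * v x)"
    by (intro Henstock_Kurzweil_Integration.integral_add integrable_continuous_interval continuous_intros v v' c')
  ultimately show "(LINT x|lebesgue_on {l<..<r}. v x * partial UNIV 1 \<phi> x) =
      - (LINT x|lebesgue_on {l<..<r}. v' x * \<phi> x)"
    unfolding p using closed[OF v c'(2) z(3,4)] closed[OF v' c'(1) z(1,2)] by (simp add: mult.commute)
qed

lemma has_weak_partial_cong:
  assumes "has_weak_partial U b f g" "\<And>x. x \<in> U \<Longrightarrow> f x = f' x"
  shows "has_weak_partial U b f' g"
proof -
  have "integrable (lebesgue_on K) f \<longleftrightarrow> integrable (lebesgue_on K) f'" if "K \<subseteq> U" for K
    by (rule Bochner_Integration.integrable_cong) (use assms(2) that in auto)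
  moreover have "(LINT x|lebesgue_on U. f x * h x) = (LINT x|lebesgue_on U. f' x * h x)" for h
    by (rule Bochner_Integration.integral_cong) (use assms(2) in auto)
  ultimately show ?thesis
    using assms(1) by (simp add: has_weak_partial_def L1_loc_def)
qed

lemma has_weak_partial_cong_AE:
  fixes f f' g :: "real \<Rightarrow> real"
  assumes weak: "has_weak_partial U 1 f g" and ae: "AE x in lebesgue_on U. f x = f' x"
    and f: "f \<in> borel_measurable (lebesgue_on U)" and f': "f' \<in> borel_measurable (lebesgue_on U)" "f' \<in> L1_loc U"
    and U: "U \<in> sets lebesgue"
  shows "has_weak_partial U 1 f' g"
  unfolding has_weak_partial_def
proof (intro conjI ballI)
  show "f' \<in> L1_loc U" by fact
  show "g \<in> L1_loc U" using weak by (simp add: has_weak_partial_def)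
  fix \<phi> :: "real \<Rightarrow> real" assume \<phi>: "\<phi> \<in> test_functions U"
  obtain \<phi>' where "continuous_on UNIV \<phi>'" and p: "partial UNIV 1 \<phi> = \<phi>'"
    using test_function_derivative[OF \<phi>] by metis
  then have m: "\<phi>' \<in> borel_measurable (lebesgue_on U)"
    using continuous_imp_measurable_on_sets_lebesgue[OF _ U] continuous_on_subset by blast
  have "(LINT x|lebesgue_on U. f x * \<phi>' x) = (LINT x|lebesgue_on U. f' x * \<phi>' x)"
    by (rule integral_cong_AE) (use ae f f' m in auto)
  then show "(LINT x|lebesgue_on U. f' x * partial UNIV 1 \<phi> x) = - (LINT x|lebesgue_on U. g x * \<phi> x)"
    using weak \<phi> by (auto simp: has_weak_partial_def p)
qed

lemma continuous_on_Icc_imp_L2: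
  fixes f :: "real \<Rightarrow> real"
  assumes "continuous_on {l..r} f"
  shows "f \<in> L2 {l<..<r}"
proof -
  have "{l<..<r} \<subseteq> {l..r}" by auto
  then have "f \<in> borel_measurable (lebesgue_on {l<..<r})"
    using assms by (intro continuous_imp_measurable_on_sets_lebesgue continuous_on_subset[OF assms]) auto
  moreover have "integrable (lebesgue_on {l<..<r}) (\<lambda>x. (f x)\<^sup>2)"
    by (rule integrable_lebesgue_on_subset[of "{l..r}"])
      (auto intro!: integrable_lebesgue_on_continuous continuous_intros assms)
  ultimately show ?thesis by (simp add: L2_def)
qed

section \<open>The obstacle problem\<close>

text \<open>The Sobolev condition provides some first weak derivative \<open>g1\<close>, not
  necessarily a continuous one. It agrees almost everywhere with the classical derivative
  \<open>v1\<close>, so the weak derivative of \<open>g1\<close> is also one of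
  \<open>v1\<close>.\<close>

lemma H2_D_derivatives:
  assumes L: "L > 0" and v: "v \<in> H2_D L"
  obtains v1 v2 where "continuous_on {-L..L} v1"
    "\<And>x. x \<in> {-L..L} \<Longrightarrow> (v has_real_derivative v1 x) (at x within {-L..L})"
    "\<And>x. x \<in> dom_D L \<Longrightarrow> (v has_real_derivative v1 x) (at x)"
    "has_weak_partial (dom_D L) 1 v1 v2" "v2 \<in> L2 (dom_D L)"
proof -
  from v have "Ck_on (Suc 0) {-L..L} v" by (simp add: H2_D_def)
  then obtain v' where v': "\<And>x. x \<in> {-L..L} \<Longrightarrow> (v has_derivative v' x) (at x within {-L..L})"
    and c: "continuous_on {-L..L} (\<lambda>x. v' x 1)"
    unfolding Ck_on.simps Basis_real_def by blast
  define v1 where "v1 = (\<lambda>x. v' x 1)"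
  have c1: "continuous_on {-L..L} v1" using c by (simp add: v1_def)
  have d: "(v has_real_derivative v1 x) (at x within {-L..L})" if "x \<in> {-L..L}" for x
  proof (rule has_derivative_imp_has_field_derivative[OF v'[OF that]])
    show "y * v1 x = v' x y" for y
      using linear_cmul[OF has_derivative_linear[OF v'[OF that]], of y 1] by (simp add: v1_def)
  qed
  have d': "(v has_real_derivative v1 x) (at x)" if "x \<in> dom_D L" for x
    using d[of x] that at_within_Icc_at[of "-L" x L] by (auto simp: dom_D_def)
  obtain g1 v2 where g1: "has_weak_partial (dom_D L) 1 v g1" "g1 \<in> L2 (dom_D L)"
    and v2: "has_weak_partial (dom_D L) 1 g1 v2" "v2 \<in> L2 (dom_D L)"
    using v by (auto simp: H2_D_def numeral_2_eq_2)
  have weak: "has_weak_partial (dom_D L) 1 v v1"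
    unfolding dom_D_def using L by (intro C1_imp_has_weak_partial c1 d) auto
  have sub: "dom_D L \<subseteq> {-L..L}" and D: "dom_D L \<in> sets lebesgue" by (auto simp: dom_D_def)
  have "continuous_on {-L..L} v" using d DERIV_continuous_on by blast
  then have "continuous_on {-L<..<L} v" using continuous_on_subset sub unfolding dom_D_def by blast
  then have "AE x in lebesgue_on (dom_D L). g1 x = v1 x"
    unfolding dom_D_def
    by (rule weak_partial_unique_AE[OF g1(1)[unfolded dom_D_def] weak[unfolded dom_D_def] _ refl])
  moreover have "v1 \<in> borel_measurable (lebesgue_on (dom_D L))"
    using continuous_on_Icc_imp_L2[OF c1] by (simp add: L2_def dom_D_def)
  ultimately have "has_weak_partial (dom_D L) 1 v1 v2"
  proof (intro has_weak_partial_cong_AE[OF v2(1) _ _ _ _ D])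
    show "g1 \<in> borel_measurable (lebesgue_on (dom_D L))" using g1(2) by (simp add: L2_def)
    show "v1 \<in> L1_loc (dom_D L)" using weak unfolding has_weak_partial_def by blast
  qed
  from that[OF c1 d d' this v2(2)] show ?thesis .
qed

lemma H2_D_I:
  assumes L: "L > 0" and v0: "v (-L) = 0" "v L = 0" "v1 (-L) = 0" "v1 L = 0"
    and c1: "continuous_on {-L..L} v1"
    and d: "\<And>x. x \<in> {-L..L} \<Longrightarrow> (v has_real_derivative v1 x) (at x within {-L..L})"
    and weak: "has_weak_partial (dom_D L) 1 v1 v2" and v2: "v2 \<in> L2 (dom_D L)"
  shows "v \<in> H2_D L"
proof -
  have c: "continuous_on {-L..L} v" using d DERIV_continuous_on by blast
  have "has_weak_partial (dom_D L) 1 v v1"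
    unfolding dom_D_def using L by (intro C1_imp_has_weak_partial c1 d) auto
  moreover have "v \<in> L2 (dom_D L)" "v1 \<in> L2 (dom_D L)"
    using continuous_on_Icc_imp_L2 c c1 by (auto simp: dom_D_def)
  ultimately have "v \<in> sobolev 2 (dom_D L)"
    using weak v2 by (auto simp: numeral_2_eq_2)
  moreover have "Ck_on 1 {-L..L} v"
  proof -
    have "\<exists>v'. (\<forall>x\<in>{-L..L}. (v has_derivative v' x) (at x within {-L..L})) \<and>
        (\<forall>b\<in>Basis. continuous_on {-L..L} (\<lambda>x. v' x b))"
      using c1 d by (intro exI[of _ "\<lambda>x h. v1 x * h"]) (auto simp: has_field_derivative_def)
    with c show ?thesis by (simp add: One_nat_def)
  qed
  ultimately show ?thesis
    using L v0 d[of "-L"] d[of L] by (simp add: H2_D_def)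
qed

lemma has_weak_partial_weak_partial:
  "has_weak_partial U b f g \<Longrightarrow> has_weak_partial U b f (weak_partial U b f)"
  unfolding weak_partial_def by (rule someI[of "has_weak_partial U b f"])

text \<open>\<open>D2\<close> chooses a weak derivative of \<open>deriv v\<close>. Almost everywhere
  it is the explicit one, because \<open>deriv v\<close> equals the continuous function
  \<open>v1\<close> on the domain and weak derivatives of continuous functions are unique.\<close>

lemma D2_AE_eq:
  assumes d: "\<And>x. x \<in> dom_D L \<Longrightarrow> (v has_real_derivative v1 x) (at x)"
    and c: "continuous_on (dom_D L) v1" and weak: "has_weak_partial (dom_D L) 1 v1 v2"
  shows "AE x in lebesgue_on (dom_D L). D2 L v x = v2 x"
proof -
  have eq: "deriv v x = v1 x" if "x \<in> dom_D L" for x using d[OF that] by (rule DERIV_imp_deriv)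
  have "has_weak_partial (dom_D L) 1 (deriv v) v2"
    by (rule has_weak_partial_cong[OF weak]) (simp add: eq)
  then have weak': "has_weak_partial (dom_D L) 1 (deriv v) (D2 L v)"
    unfolding D2_def by (rule has_weak_partial_weak_partial)
  have c': "continuous_on (dom_D L) (deriv v)"
    by (rule continuous_on_eq[OF c]) (simp add: eq)
  show ?thesis
    unfolding dom_D_def
    by (rule weak_partial_unique_AE[OF weak'[unfolded dom_D_def] weak[unfolded dom_D_def]
          c'[unfolded dom_D_def] eq[unfolded dom_D_def]])
qed

section \<open>Flattening between two contact points\<close>

lemma flatten_has_derivative:
  fixes u u1 :: "real \<Rightarrow> real"
  assumes d: "(u has_real_derivative u1 x) (at x within S)" and x: "x \<in> S"
    and p: "u p = c" "u1 p = 0" and q: "u q = c" "u1 q = 0"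
  shows "((\<lambda>y. if y \<in> {p..q} then c else u y) has_real_derivative
    u1 x - (if x \<in> {p..q} then u1 x else 0)) (at x within S)" (is "(?w has_real_derivative _) _")
proof -
  consider "x \<in> {p<..<q}" | "x \<notin> {p..q}" | "x = p \<or> x = q" "x \<in> {p..q}" by fastforce
  then show ?thesis
  proof cases
    case 1
    then obtain e where e: "e > 0" "ball x e \<subseteq> {p<..<q}"
      using open_greaterThanLessThan open_contains_ball by metis
    have "((\<lambda>y. c) has_real_derivative 0) (at x within S)" by simp
    then have "(?w has_real_derivative 0) (at x within S)"
    proof (rule has_field_derivative_transform_within[OF _ e(1) x])
      show "c = ?w y" if "dist y x < e" for y
        using subsetD[OF e(2), of y] that by (simp add: dist_commute)
    qed
    with 1 show ?thesis by simp
  next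
    case 2
    moreover have "open (- {p..q})" by auto
    ultimately obtain e where e: "e > 0" "ball x e \<subseteq> - {p..q}"
      unfolding open_contains_ball by (metis ComplI)
    from d have "(?w has_real_derivative u1 x) (at x within S)"
    proof (rule has_field_derivative_transform_within[OF _ e(1) x])
      show "u y = ?w y" if "dist y x < e" for y
      proof -
        have "y \<in> ball x e" using that by (simp add: dist_commute)
        with e(2) have "y \<notin> {p..q}" by blast
        then show ?thesis by (simp only: if_False)
      qed
    qed
    with 2 show ?thesis by (simp only: if_False diff_zero)
  next
    case 3
    then have ux: "u x = c" "u1 x = 0" using p q by auto
    \<comment> \<open>At a junction the quotient of the flattened function is either 0 or that of
      \<open>u\<close>, and the latter tends to 0. The comparison treats both sides of the junction
      at once.\<close>
    have "((\<lambda>y. (?w y - ?w x) / (y - x)) \<longlongrightarrow> 0) (at x within S)"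
    proof (rule tendsto_0_le[where K = 1])
      show "((\<lambda>y. (u y - u x) / (y - x)) \<longlongrightarrow> 0) (at x within S)"
        using d ux by (simp add: has_field_derivative_iff)
      show "\<forall>\<^sub>F y in at x within S. norm ((?w y - ?w x) / (y - x)) \<le> norm ((u y - u x) / (y - x)) * 1"
        using ux by (intro always_eventually) auto
    qed
    with 3 ux show ?thesis by (simp add: has_field_derivative_iff)
  qed
qed

lemma L2_diff_restrict:
  fixes f :: "real \<Rightarrow> real"
  assumes f: "f \<in> L2 U" and A: "A \<in> sets lebesgue" and U: "U \<in> sets lebesgue"
  shows "(\<lambda>x. f x - (if x \<in> A then f x else 0)) \<in> L2 U"
proof -
  have fm[measurable]: "f \<in> borel_measurable (lebesgue_on U)" and int: "integrable (lebesgue_on U) (\<lambda>x. (f x)\<^sup>2)"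
    using f by (auto simp: L2_def)
  have "(indicator A :: real \<Rightarrow> real) \<in> borel_measurable lebesgue" using A by simp
  then have im[measurable]: "(indicator A :: real \<Rightarrow> real) \<in> borel_measurable (lebesgue_on U)"
    by (rule measurable_restrict_space1)
  have eq: "(\<lambda>x. f x - (if x \<in> A then f x else 0)) = (\<lambda>x. f x - indicator A x * f x)"
    by (auto simp: indicator_def)
  have m: "(\<lambda>x. f x - indicator A x * f x) \<in> borel_measurable (lebesgue_on U)" by measurable
  moreover have "integrable (lebesgue_on U) (\<lambda>x. (f x - indicator A x * f x)\<^sup>2)"
    by (rule Bochner_Integration.integrable_bound[OF int]) (use m in \<open>auto simp: indicator_def\<close>)
  ultimately show ?thesis unfolding eq by (simp add: L2_def)
qed

text \<open>Lebesgue measure is complete, so \<open>g\<close> inherits measurability from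
  \<open>f\<close>. This allows a comparison with the integrand built from \<open>D2\<close> and
  \<open>deriv\<close>, whose measurability is not established separately.\<close>

lemma integral_cong_AE_lebesgue_on:
  fixes f g :: "'a::euclidean_space \<Rightarrow> real"
  assumes ae: "AE x in lebesgue_on S. f x = g x" and S: "S \<in> sets lebesgue"
    and f: "f \<in> borel_measurable (lebesgue_on S)"
  shows "integral\<^sup>L (lebesgue_on S) f = integral\<^sup>L (lebesgue_on S) g"
proof -
  have "AE x in lebesgue. (if x \<in> S then f x else 0) = (if x \<in> S then g x else 0)"
    using ae S by (simp add: AE_restrict_space_iff)
  then have "(\<lambda>x. if x \<in> S then g x else 0) \<in> borel_measurable lebesgue"
    by (rule borel_measurable_AE[OF borel_measurable_if_I[OF f S]])
  then have "g \<in> borel_measurable (lebesgue_on S)" by (rule borel_measurable_if_D)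
  with f ae show ?thesis by (intro integral_cong_AE)
qed

lemma weak_solution_coincidence_interval:
  assumes L: "L > 0" and \<beta>: "\<beta> > 0" and \<tau>: "\<tau> \<ge> 0" and \<alpha>: "\<alpha> \<ge> 0"
    and g: "\<And>x. x \<in> dom_D L \<Longrightarrow> g x \<ge> 0"
    and sol: "weak_solution L H \<beta> \<tau> \<alpha> g u"
  shows "is_interval (coincidence_set L H u)"
  unfolding is_interval_1
proof (intro ballI allI impI)
  fix p q r assume p: "p \<in> coincidence_set L H u" and q: "q \<in> coincidence_set L H u" and r: "p \<le> r \<and> r \<le> q"
  have pq: "-L < p" "q < L" "u p = -H" "u q = -H"
    using p q by (auto simp: coincidence_set_def dom_D_def)
  have "u r = -H"
  proof (cases "p < q")
    case False
    then show ?thesis using r pq by (cases "r = p") auto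
  next
    case True
    define D where "D = dom_D L"
    define M where "M = lebesgue_on D"
    have D: "D \<in> sets lebesgue" by (simp add: D_def dom_D_def)
    have pqD: "{p..q} \<subseteq> D" and D_sub: "D \<subseteq> {-L..L}" using pq by (auto simp: D_def dom_D_def)
    have u: "u \<in> H2_D L" and uH: "\<And>x. x \<in> D \<Longrightarrow> u x \<ge> -H"
      using sol by (auto simp: weak_solution_def S0_bar_def D_def)
    obtain u1 u2 where c1: "continuous_on {-L..L} u1"
      and d: "\<And>x. x \<in> {-L..L} \<Longrightarrow> (u has_real_derivative u1 x) (at x within {-L..L})"
      and d': "\<And>x. x \<in> D \<Longrightarrow> (u has_real_derivative u1 x) (at x)"
      and weak: "has_weak_partial D 1 u1 u2" and u2: "u2 \<in> L2 D"
      using H2_D_derivatives[OF L u] unfolding D_def by blast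
    \<comment> \<open>A contact point is a minimum of \<open>u\<close> over the domain, and an
      interior one: the radius used is the distance from \<open>y\<close> to the boundary.\<close>
    have zero: "u1 y = 0" if "y \<in> D" "u y = -H" for y
    proof (rule DERIV_local_min[OF d'[OF that(1)], of "min (y + L) (L - y)"])
      show "0 < min (y + L) (L - y)" using that by (auto simp: D_def dom_D_def)
      show "\<forall>z. \<bar>y - z\<bar> < min (y + L) (L - y) \<longrightarrow> u y \<le> u z"
      proof (intro allI impI)
        fix z assume "\<bar>y - z\<bar> < min (y + L) (L - y)"
        then have "z \<in> D" by (auto simp: D_def dom_D_def)
        with uH that show "u y \<le> u z" by simp
      qed
    qed
    have "p \<in> D" "q \<in> D" using p q by (simp_all add: D_def coincidence_set_def)
    from zero[OF this(1) pq(3)] zero[OF this(2) pq(4)] have u1p: "u1 p = 0" and u1q: "u1 q = 0" .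
    have cpq: "continuous_on {p..q} u1"
      using continuous_on_subset[OF c1] pqD D_sub by blast
    have cD: "continuous_on D u1" by (rule continuous_on_subset[OF c1 D_sub])

    let ?ind = "\<lambda>f x. if x \<in> {p..q} then f x else (0 :: real)"
    define w where "w = (\<lambda>x. if x \<in> {p..q} then -H else u x)"
    \<comment> \<open>Subtracting the truncated part, instead of distinguishing cases, makes the
      weak derivative of \<open>w1\<close> a consequence of truncation and linearity.\<close>
    define w1 where "w1 = (\<lambda>x. u1 x - ?ind u1 x)"
    define w2 where "w2 = (\<lambda>x. u2 x - ?ind u2 x)"
    have dw: "(w has_real_derivative w1 x) (at x within {-L..L})" if "x \<in> {-L..L}" for x
      unfolding w_def w1_def by (rule flatten_has_derivative[OF d[OF that] that pq(3) u1p pq(4) u1q])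
    have dw': "(w has_real_derivative w1 x) (at x)" if "x \<in> D" for x
      unfolding w_def w1_def
      by (rule flatten_has_derivative[OF d'[OF that] UNIV_I pq(3) u1p pq(4) u1q])
    have weak_ind: "has_weak_partial D 1 (?ind u1) (?ind u2)"
      by (rule has_weak_partial_restrict[OF weak D pqD True cpq u1p u1q])
    have weak_w: "has_weak_partial D 1 w1 w2"
      unfolding w1_def w2_def by (rule has_weak_partial_diff[OF weak weak_ind D])
    have c_ind: "continuous_on {-L..L} (?ind u1)"
    proof -
      \<comment> \<open>The two closed pieces meet only at \<open>p\<close> and \<open>q\<close>,
        where \<open>u1\<close> vanishes.\<close>
      have "continuous_on ({p..q} \<union> ({-L..p} \<union> {q..L})) (?ind u1)"
      proof (rule continuous_on_cases)
        show "\<forall>x. x \<in> {p..q} \<and> x \<notin> {p..q} \<or> x \<in> {-L..p} \<union> {q..L} \<and> x \<in> {p..q} \<longrightarrow> u1 x = 0"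
        proof (intro allI impI)
          fix x assume "x \<in> {p..q} \<and> x \<notin> {p..q} \<or> x \<in> {-L..p} \<union> {q..L} \<and> x \<in> {p..q}"
          then have "x = p \<or> x = q" by auto
          then show "u1 x = 0" using u1p u1q by auto
        qed
      qed (auto intro: cpq)
      moreover have "{p..q} \<union> ({-L..p} \<union> {q..L}) = {-L..L}" using True pq by auto
      ultimately show ?thesis by simp
    qed
    have c_w1: "continuous_on {-L..L} w1"
      unfolding w1_def by (intro continuous_on_diff c1 c_ind)
    have notin: "-L \<notin> {p..q}" "L \<notin> {p..q}" using pq by auto
    have w2L2: "w2 \<in> L2 D"
      unfolding w2_def by (rule L2_diff_restrict[OF u2 _ D]) simp
    have w_H2: "w \<in> H2_D L"
    proof (rule H2_D_I[OF L _ _ _ _ c_w1 dw weak_w[unfolded D_def] w2L2[unfolded D_def]])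
      have bc: "u (-L) = 0" "u L = 0" "(u has_real_derivative 0) (at (-L) within {-L..L})"
        "(u has_real_derivative 0) (at L within {-L..L})"
        using u by (auto simp: H2_D_def)
      show "w (-L) = 0" "w L = 0" using notin bc by (auto simp: w_def)
      have uniq: "a = b" if "(u has_real_derivative a) (at y within {-L..L})"
        "(u has_real_derivative b) (at y within {-L..L})" "y \<in> {-L..L}" for a b y
        using vector_derivative_unique_within_closed_interval[of "-L" L y u a b] that L
        by (simp add: has_real_derivative_iff_has_vector_derivative)
      have "u1 (-L) = 0" "u1 L = 0"
        using uniq[OF d bc(3)] uniq[OF d bc(4)] L by auto
      then show "w1 (-L) = 0" "w1 L = 0" using notin by (auto simp: w1_def)
    qed
    have "w \<in> S0_bar L H"
      using w_H2 uH by (auto simp: S0_bar_def w_def D_def)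
    \<comment> \<open>The nonlocal coefficient is evaluated at the fixed solution \<open>u\<close>,
      so for the comparison it is a nonnegative constant.\<close>
    define T where "T = \<tau> + \<alpha> * (L2_norm (dom_D L) (deriv u))\<^sup>2"
    have T: "T \<ge> 0" using \<tau> \<alpha> by (simp add: T_def)
    define E where "E = (\<lambda>x. \<beta> * (u2 x)\<^sup>2 + T * (u1 x)\<^sup>2)"
    have "(LINT x|M. \<beta> * D2 L u x * D2 L (\<lambda>y. w y - u y) x + T * deriv u x * deriv (\<lambda>y. w y - u y) x)
        \<ge> - (LINT x|M. g x * (w x - u x))"
      using sol \<open>w \<in> S0_bar L H\<close> unfolding weak_solution_def T_def M_def D_def by blast
    txt \<open>No integrability of \<open>g\<close> is needed: the integral of a non-integrable function is 0.\<close>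
    moreover have "(LINT x|M. g x * (w x - u x)) \<le> 0"
    proof -
      have "(LINT x|M. - (g x * (w x - u x))) \<ge> 0"
      proof (rule Bochner_Integration.integral_nonneg)
        fix x assume "x \<in> space M"
        then have "x \<in> D" by (simp add: M_def)
        then have "g x \<ge> 0" "w x - u x \<le> 0" using g uH by (auto simp: w_def D_def)
        then show "- (g x * (w x - u x)) \<ge> 0" by (simp add: mult_nonneg_nonpos)
      qed
      then show ?thesis by simp
    qed
    ultimately have ge: "(LINT x|M. \<beta> * D2 L u x * D2 L (\<lambda>y. w y - u y) x + T * deriv u x * deriv (\<lambda>y. w y - u y) x) \<ge> 0"
      by linarith
    \<comment> \<open>Integrability is needed to read off from a zero integral that the energy
      density vanishes almost everywhere: a non-integrable function would also have integral
      0.\<close>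
    have intE: "integrable M (?ind E)"
    proof -
      have "u1 \<in> L2 D" using continuous_on_Icc_imp_L2[OF c1] by (simp add: D_def dom_D_def)
      with u2 have "integrable M E" by (simp add: E_def M_def L2_def)
      moreover have "{p..q} \<in> sets M"
        using D pqD by (simp add: M_def sets_restrict_space_iff)
      ultimately have "integrable M (\<lambda>x. E x * indicator {p..q} x)"
        by (intro integrable_real_mult_indicator)
      moreover have "(\<lambda>x. E x * indicator {p..q} x) = ?ind E" by (auto simp: indicator_def)
      ultimately show ?thesis by simp
    qed
    have "AE x in M. D2 L u x = u2 x"
      unfolding M_def D_def
      by (rule D2_AE_eq[OF d'[unfolded D_def] cD[unfolded D_def] weak[unfolded D_def]])
    moreover have "AE x in M. D2 L (\<lambda>y. w y - u y) x = w2 x - u2 x"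
      unfolding M_def D_def
      by (rule D2_AE_eq[OF DERIV_diff[OF dw'[unfolded D_def] d'[unfolded D_def]] _
            has_weak_partial_diff[OF weak_w weak D, unfolded D_def]])
        (use continuous_on_diff[OF c_w1 c1] continuous_on_subset D_sub in \<open>unfold D_def, blast\<close>)
    moreover have "AE x in M. x \<in> D" by (rule AE_I2) (simp add: M_def)
    \<comment> \<open>On \<open>{p..q}\<close> the derivatives of \<open>w - u\<close> are minus
      those of \<open>u\<close>, and elsewhere they are 0; the form thus becomes minus the energy
      density \<open>E\<close> over \<open>{p..q}\<close>.\<close>
    ultimately have "AE x in M. - ?ind E x =
        \<beta> * D2 L u x * D2 L (\<lambda>y. w y - u y) x + T * deriv u x * deriv (\<lambda>y. w y - u y) x"
    proof eventually_elim
      case (elim x)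
      have "deriv u x = u1 x" "deriv (\<lambda>y. w y - u y) x = w1 x - u1 x"
        using d'[OF elim(3)] DERIV_diff[OF dw'[OF elim(3)] d'[OF elim(3)]] by (auto intro: DERIV_imp_deriv)
      with elim show ?case
        by (simp add: E_def w1_def w2_def power2_eq_square algebra_simps)
    qed
    then have "(LINT x|M. - ?ind E x) =
        (LINT x|M. \<beta> * D2 L u x * D2 L (\<lambda>y. w y - u y) x + T * deriv u x * deriv (\<lambda>y. w y - u y) x)"
      using borel_measurable_integrable[OF integrable_minus[OF intE]]
      unfolding M_def by (intro integral_cong_AE_lebesgue_on D)
    with ge have le: "(LINT x|M. ?ind E x) \<le> 0" by simp
    have E0: "E x \<ge> 0" for x using \<beta> T by (simp add: E_def)
    then have ae0: "AE x in M. 0 \<le> ?ind E x" by simp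
    from integral_nonneg_AE[OF ae0] le have "(LINT x|M. ?ind E x) = 0" by linarith
    then have "AE x in M. ?ind E x = 0"
      using integral_nonneg_eq_0_iff_AE[OF intE ae0] by simp
    then have "AE x in lebesgue. x \<in> D \<longrightarrow> ?ind E x = 0"
      unfolding M_def by (subst (asm) AE_restrict_space_iff) (use D in auto)
    \<comment> \<open>Only the bending term is exploited: \<beta> is positive, while
      \<open>T\<close> may be 0 and then says nothing about \<open>u1\<close>.\<close>
    then have u2_0: "AE x in lebesgue. x \<in> {p..q} \<longrightarrow> u2 x = 0"
    proof eventually_elim
      case (elim x)
      show ?case
      proof
        assume x: "x \<in> {p..q}"
        with elim pqD have "E x = 0" by auto
        moreover have "\<beta> * (u2 x)\<^sup>2 \<ge> 0" "T * (u1 x)\<^sup>2 \<ge> 0" using \<beta> T by auto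
        ultimately have "\<beta> * (u2 x)\<^sup>2 = 0" unfolding E_def by linarith
        with \<beta> show "u2 x = 0" by simp
      qed
    qed
    \<comment> \<open>The slope is recovered by integrating \<open>u2\<close> from \<open>p\<close>,
      where \<open>u1\<close> is 0; this gives every point of \<open>{p..q}\<close>, not merely
      almost every one.\<close>
    have u1_0: "u1 x = 0" if x: "x \<in> {p..q}" for x
    proof (cases "x = p")
      case False
      have px: "{p..x} \<subseteq> {p..q}" and "p < x" using x False by auto
      have "AE y in lebesgue_on {p..x}. u2 y = 0"
        using u2_0 by (simp add: AE_restrict_space_iff, elim eventually_mono) (use px in auto)
      then have "(LINT y|lebesgue_on {p..x}. u2 y) = 0" by (rule integral_eq_zero_AE)
      with weak_partial_FTC[OF weak D subset_trans[OF px pqD] \<open>p < x\<close> continuous_on_subset[OF cpq px]] u1p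
      show ?thesis by simp
    qed (use u1p in simp)
    have "\<exists>c. \<forall>x\<in>{p..q}. u x = c"
    proof (rule has_field_derivative_zero_constant)
      show "(u has_real_derivative 0) (at x within {p..q})" if "x \<in> {p..q}" for x
        using d'[of x] u1_0[OF that] that pqD has_field_derivative_at_within by force
    qed simp
    then have "u r = u p" using r True by auto
    with pq show ?thesis by simp
  qed
  moreover have "r \<in> dom_D L" using r pq by (auto simp: dom_D_def)
  ultimately show "r \<in> coincidence_set L H u" by (simp add: coincidence_set_def)
qed

section \<open>Sign of the electrostatic force\<close>

lemma has_derivative_direction_zero:
  fixes f :: "'a::real_normed_vector \<Rightarrow> real"
  assumes f: "(f has_derivative A) (at a within S)" and \<delta>: "\<delta> > 0"
    and const: "\<And>t. t \<in> {0..\<delta>} \<Longrightarrow> a + t *\<^sub>R v \<in> S \<and> f (a + t *\<^sub>R v) = c"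
  shows "A v = 0"
proof -
  \<comment> \<open>A segment leaving \<open>a\<close> in the direction \<open>v\<close> is enough,
    because derivatives within \<open>{0..\<delta>}\<close> are unique even at the endpoint 0. This
    covers boundary points of the domain, such as those with w = -H, from which only forward
    directions are available.\<close>
  define \<gamma> where "\<gamma> = (\<lambda>t. a + t *\<^sub>R v)"
  have d\<gamma>: "(\<gamma> has_derivative (\<lambda>t. t *\<^sub>R v)) (at 0 within {0..\<delta>})"
    unfolding \<gamma>_def by (auto intro!: derivative_eq_intros)
  have "(f has_derivative A) (at (\<gamma> 0) within \<gamma> ` {0..\<delta>})"
    by (rule has_derivative_subset[of _ _ _ S]) (use f const in \<open>auto simp: \<gamma>_def\<close>)
  then have "((\<lambda>t. f (\<gamma> t)) has_derivative (\<lambda>t. A (t *\<^sub>R v))) (at 0 within {0..\<delta>})"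
    by (rule has_derivative_in_compose[OF d\<gamma>])
  then have 1: "((\<lambda>t. f (\<gamma> t)) has_real_derivative A v) (at 0 within {0..\<delta>})"
    by (rule has_derivative_imp_has_field_derivative)
      (simp add: linear_cmul[OF has_derivative_linear[OF f]])
  have "((\<lambda>t. f (\<gamma> t)) has_real_derivative 0) (at 0 within {0..\<delta>})"
  proof (rule has_field_derivative_transform_within[OF _ zero_less_one])
    show "((\<lambda>t. c) has_real_derivative 0) (at 0 within {0..\<delta>})" by simp
    show "c = f (\<gamma> t)" if "t \<in> {0..\<delta>}" for t using const[OF that] by (simp add: \<gamma>_def)
  qed (use \<delta> in auto)
  with 1 show ?thesis
    using vector_derivative_unique_within_closed_interval[of 0 \<delta> 0 "\<lambda>t. f (\<gamma> t)" "A v" 0] \<delta>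
    by (simp add: has_real_derivative_iff_has_vector_derivative)
qed

lemma Ck_on_2_has_derivative:
  assumes "Ck_on 2 S f" "x \<in> S"
  shows "(f has_derivative frechet_derivative f (at x within S)) (at x within S)"
proof -
  have "Ck_on (Suc 1) S f" using assms(1) by (simp add: numeral_2_eq_2)
  then have "f differentiable (at x within S)"
    unfolding Ck_on.simps differentiable_def using assms(2) by blast
  then show ?thesis by (simp add: frechet_derivative_works)
qed

lemma g_force_nonneg:
  assumes "d > 0" "\<sigma>2 > 0"
    and h1: "Ck_on 2 (dom_h1 L H d) h1" and h2: "Ck_on 2 (dom_h2 L H) h2"
    and h1_0: "\<forall>x\<in>{-L..L}. \<forall>w\<ge>-H. h1 (x, -H-d, w) = 0"
    and h2_V: "\<forall>x\<in>{-L..L}. \<forall>w\<ge>-H. h2 (x, w, w) = V"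
    and x: "x \<in> dom_D L" and ux: "u x \<ge> -H"
  shows "g_force L H d \<sigma>1 \<sigma>2 h1 h2 u x \<ge> 0"
proof -
  have xL: "-L < x" "x < L" using x by (auto simp: dom_D_def)
  have in1: "(x, -H-d, u x) \<in> dom_h1 L H d" and in2: "(x, u x, u x) \<in> dom_h2 L H"
    using xL ux \<open>d > 0\<close> by (auto simp: dom_h1_def dom_h2_def)
  note d1 = Ck_on_2_has_derivative[OF h1 in1] and d2 = Ck_on_2_has_derivative[OF h2 in2]
  have w1: "partial (dom_h1 L H d) e_w h1 (x, -H-d, u x) = 0"
    unfolding partial_def
    by (rule has_derivative_direction_zero[OF d1 zero_less_one])
      (use xL ux \<open>d > 0\<close> h1_0 in \<open>auto simp: dom_h1_def\<close>)
  \<comment> \<open>The length \<open>L - x\<close> is the largest one that keeps the first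
    coordinate in the closed interval.\<close>
  have x2: "partial (dom_h2 L H) e_x h2 (x, u x, u x) = 0"
    unfolding partial_def
    by (rule has_derivative_direction_zero[OF d2, of "L - x"])
      (use xL ux h2_V in \<open>auto simp: dom_h2_def\<close>)
  \<comment> \<open>The diagonal direction is tangent to the surface z = w on which
    \<open>h2\<close> is constant. It controls the sum of the z- and w-derivatives, which is exactly
    the combination squared in the force.\<close>
  have "frechet_derivative h2 (at (x, u x, u x) within dom_h2 L H) (e_z + e_w) = 0"
    by (rule has_derivative_direction_zero[OF d2 zero_less_one])
      (use xL ux h2_V in \<open>auto simp: dom_h2_def\<close>)
  then have zw2: "partial (dom_h2 L H) e_z h2 (x, u x, u x) + partial (dom_h2 L H) e_w h2 (x, u x, u x) = 0"
    unfolding partial_def linear_add[OF has_derivative_linear[OF d2]] .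
  have "g_force L H d \<sigma>1 \<sigma>2 h1 h2 u x = g_frak L H d \<sigma>1 \<sigma>2 h1 h2 u x"
    using w1 x2 zw2 by (simp add: g_force_def at_u_def)
  also have "\<dots> \<ge> 0" using \<open>\<sigma>2 > 0\<close> by (simp add: g_frak_def)
  finally show ?thesis .
qed

theorem corollary1p5:
  fixes L H d \<beta> \<tau> \<alpha> \<sigma>2 V :: real
    and \<sigma>1 :: "real \<times> real \<Rightarrow> real"
    and h1 h2 :: "real \<times> real \<times> real \<Rightarrow> real"
    and u :: "real \<Rightarrow> real"
  assumes "L > 0" and "H > 0" and "d > 0"
    and "\<beta> > 0" and "\<tau> \<ge> 0" and "\<alpha> \<ge> 0"
    and "Ck_on 2 (closure (Omega1 L H d)) \<sigma>1"
    and "(INF p\<in>closure (Omega1 L H d). \<sigma>1 p) > 0"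
    and "\<sigma>2 > 0"
    and "Ck_on 2 (dom_h1 L H d) h1" and "\<forall>p\<in>dom_h1 L H d. h1 p \<ge> 0"
    and "Ck_on 2 (dom_h2 L H) h2" and "\<forall>p\<in>dom_h2 L H. h2 p \<ge> 0"
    and "\<forall>x\<in>dom_D L. \<forall>w\<ge>-H. h1 (x, -H, w) = h2 (x, -H, w)"
    and "\<forall>x\<in>dom_D L. \<forall>w\<ge>-H. \<sigma>1 (x, -H) * partial (dom_h1 L H d) e_z h1 (x, -H, w)
                              = \<sigma>2 * partial (dom_h2 L H) e_z h2 (x, -H, w)"
    and "V > 0"
    and "\<forall>x\<in>{-L..L}. \<forall>w\<ge>-H. h1 (x, -H-d, w) = 0"
    and "\<forall>x\<in>{-L..L}. \<forall>w\<ge>-H. h2 (x, w, w) = V"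
    and "weak_solution L H \<beta> \<tau> \<alpha> (g_force L H d \<sigma>1 \<sigma>2 h1 h2 u) u"
    and "coincidence_set L H u \<noteq> {}"
  shows "is_interval (coincidence_set L H u)"
proof (rule weak_solution_coincidence_interval[OF assms(1,4-6) _ assms(19)])
  fix x assume x: "x \<in> dom_D L"
  have "u x \<ge> -H" using assms(19) x by (auto simp: weak_solution_def S0_bar_def)
  then show "g_force L H d \<sigma>1 \<sigma>2 h1 h2 u x \<ge> 0"
    using g_force_nonneg[OF assms(3,9,10,12,17,18) x] by blast
qed

end
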